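(* Let $M$ be an irreducible weight module of $\mathfrak{L}$ and suppose there exists $\lambda\in\mathbb{C}$ such that $\dim M_{\lambda}=\infty$. Then $\mathrm{Supp}(M)=\lambda+\mathbb{Z}$, and $\dim M_{\lambda+k}=\infty$ for every $k\in\mathbb{Z}$.
   Context: $\mathfrak{L}$ (the super $W(2,2)$ algebra) is the Lie superalgebra over $\mathbb{C}$ with basis $\{L_n,I_n,G_n,H_n\mid n\in\mathbb{Z}\}$, even part spanned by the $L_n,I_n$ and odd part spanned by the $G_n,H_n$, and with non-vanishing brackets (for $m,n\in\mathbb{Z}$) $[L_m,L_n]=(m-n)L_{m+n}$, $[L_m,I_n]=(m-n)I_{m+n}$, $[L_m,H_n]=(\frac{m}{2}-n)H_{m+n}$, $[G_m,G_n]=I_{m+n}$, $[L_m,G_n]=(\frac{m}{2}-n)G_{m+n}$, $[I_m,G_n]=(m-2n)H_{m+n}$; brackets of basis elements that do not follow from these by super-antisymmetry are zero. The Cartan subalgebra is $\mathfrak{h}=\mathbb{C}L_0$. A weight module ($\mathfrak{h}$-diagonalisable module) is an $\mathfrak{L}$-module $M=\bigoplus_{\lambda\in\mathbb{C}}M_\lambda$ with $M_\lambda=\{x\in M\mid L_0x=-\lambda x\}$, and $\mathrm{Supp}(M)=\{\lambda\in\mathbb{C}\mid M_\lambda\neq 0\}$. *)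

theory Defs
  imports Complex_Main "HOL-Library.Poly_Mapping" "HOL-Library.Z2"
begin

section \<open>Lie superalgebras over the complex numbers and their modules\<close>

text \<open>Parities are elements of the field \<^typ>\<open>bit\<close> of two elements; \<open>koszul i j\<close> is
  $(-1)^{ij}$.\<close>

definition koszul :: "bit \<Rightarrow> bit \<Rightarrow> complex" where
  "koszul i j = (if i = 1 \<and> j = 1 then -1 else 1)"

locale super_vector_space = vector_space scale
  for scale :: "complex \<Rightarrow> 'a::ab_group_add \<Rightarrow> 'a" +
  fixes grade :: "bit \<Rightarrow> 'a set"
  assumes grade_subspace: "subspace (grade i)"
    and grade_sum: "\<exists>x\<in>grade 0. \<exists>y\<in>grade 1. v = x + y"
    and grade_disjoint: "grade 0 \<inter> grade 1 = {0}"

locale lie_superalgebra = super_vector_space scale grade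
  for scale :: "complex \<Rightarrow> 'g::ab_group_add \<Rightarrow> 'g"
    and grade :: "bit \<Rightarrow> 'g set" +
  fixes bracket :: "'g \<Rightarrow> 'g \<Rightarrow> 'g"
  assumes bracket_add_left: "bracket (x + y) z = bracket x z + bracket y z"
    and bracket_add_right: "bracket z (x + y) = bracket z x + bracket z y"
    and bracket_scale_left: "bracket (scale c x) z = scale c (bracket x z)"
    and bracket_scale_right: "bracket z (scale c x) = scale c (bracket z x)"
    and bracket_grade: "x \<in> grade i \<Longrightarrow> y \<in> grade j \<Longrightarrow> bracket x y \<in> grade (i + j)"
    and super_antisym:
      "x \<in> grade i \<Longrightarrow> y \<in> grade j \<Longrightarrow> bracket x y = - scale (koszul i j) (bracket y x)"
    and super_jacobi:
      "x \<in> grade i \<Longrightarrow> y \<in> grade j \<Longrightarrow>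
        bracket x (bracket y z) =
          bracket (bracket x y) z + scale (koszul i j) (bracket y (bracket x z))"

text \<open>As usual for Lie superalgebras, modules are \<open>\<int>/2\<close>-graded, submodules are graded
  subspaces, and irreducibility refers to these.\<close>

locale lie_supermodule =
  g: lie_superalgebra gscale ggrade bracket + super_vector_space scale grade
  for gscale :: "complex \<Rightarrow> 'g::ab_group_add \<Rightarrow> 'g"
    and ggrade :: "bit \<Rightarrow> 'g set"
    and bracket :: "'g \<Rightarrow> 'g \<Rightarrow> 'g"
    and scale :: "complex \<Rightarrow> 'v::ab_group_add \<Rightarrow> 'v"
    and grade :: "bit \<Rightarrow> 'v set" +
  fixes act :: "'g \<Rightarrow> 'v \<Rightarrow> 'v"
  assumes act_add_left: "act (x + y) v = act x v + act y v"
    and act_add_right: "act x (v + w) = act x v + act x w"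
    and act_scale_left: "act (gscale c x) v = scale c (act x v)"
    and act_scale_right: "act x (scale c v) = scale c (act x v)"
    and act_grade: "x \<in> ggrade i \<Longrightarrow> v \<in> grade j \<Longrightarrow> act x v \<in> grade (i + j)"
    and act_bracket:
      "x \<in> ggrade i \<Longrightarrow> y \<in> ggrade j \<Longrightarrow>
        act (bracket x y) v = act x (act y v) - scale (koszul i j) (act y (act x v))"
begin

definition submodule :: "'v set \<Rightarrow> bool" where
  "submodule N \<longleftrightarrow> subspace N
     \<and> (\<forall>v\<in>N. \<exists>x\<in>N \<inter> grade 0. \<exists>y\<in>N \<inter> grade 1. v = x + y)
     \<and> (\<forall>x. \<forall>v\<in>N. act x v \<in> N)"

definition irreducible_module :: bool where
  "irreducible_module \<longleftrightarrow>
     (UNIV :: 'v set) \<noteq> {0} \<and> (\<forall>N. submodule N \<longrightarrow> N = {0} \<or> N = UNIV)"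

end

definition (in vector_space) infinite_dimensional :: "'b set \<Rightarrow> bool" where
  "infinite_dimensional S \<longleftrightarrow> \<not> (\<exists>B. finite B \<and> span B = S)"


section \<open>The super $W(2,2)$ algebra\<close>

text \<open>Its elements are the finitely supported complex-valued functions on the set of basis
  symbols.\<close>

datatype W22_basis = bL int | bI int | bG int | bH int

type_synonym W22 = "W22_basis \<Rightarrow>\<^sub>0 complex"

definition W22_scale :: "complex \<Rightarrow> W22 \<Rightarrow> W22" where
  "W22_scale c x = Poly_Mapping.map ((*) c) x"

fun W22_parity :: "W22_basis \<Rightarrow> bit" where
  "W22_parity (bL n) = 0"
| "W22_parity (bI n) = 0"
| "W22_parity (bG n) = 1"
| "W22_parity (bH n) = 1"

definition W22_grade :: "bit \<Rightarrow> W22 set" where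
  "W22_grade i = {x. \<forall>b\<in>Poly_Mapping.keys x. W22_parity b = i}"

text \<open>The equations for \<open>[I, L]\<close>, \<open>[H, L]\<close>, \<open>[G, L]\<close>, \<open>[G, I]\<close> are those forced by
  super-antisymmetry.\<close>

fun W22_basis_bracket :: "W22_basis \<Rightarrow> W22_basis \<Rightarrow> W22" where
  "W22_basis_bracket (bL m) (bL n) = Poly_Mapping.single (bL (m + n)) (of_int m - of_int n)"
| "W22_basis_bracket (bL m) (bI n) = Poly_Mapping.single (bI (m + n)) (of_int m - of_int n)"
| "W22_basis_bracket (bL m) (bH n) = Poly_Mapping.single (bH (m + n)) (of_int m / 2 - of_int n)"
| "W22_basis_bracket (bG m) (bG n) = Poly_Mapping.single (bI (m + n)) 1"
| "W22_basis_bracket (bL m) (bG n) = Poly_Mapping.single (bG (m + n)) (of_int m / 2 - of_int n)"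
| "W22_basis_bracket (bI m) (bG n) = Poly_Mapping.single (bH (m + n)) (of_int m - 2 * of_int n)"
| "W22_basis_bracket (bI n) (bL m) = - Poly_Mapping.single (bI (m + n)) (of_int m - of_int n)"
| "W22_basis_bracket (bH n) (bL m) = - Poly_Mapping.single (bH (m + n)) (of_int m / 2 - of_int n)"
| "W22_basis_bracket (bG n) (bL m) = - Poly_Mapping.single (bG (m + n)) (of_int m / 2 - of_int n)"
| "W22_basis_bracket (bG n) (bI m) = - Poly_Mapping.single (bH (m + n)) (of_int m - 2 * of_int n)"
| "W22_basis_bracket _ _ = 0"

definition W22_bracket :: "W22 \<Rightarrow> W22 \<Rightarrow> W22" where
  "W22_bracket x y =
     (\<Sum>a\<in>Poly_Mapping.keys x. \<Sum>b\<in>Poly_Mapping.keys y.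
        W22_scale (Poly_Mapping.lookup x a * Poly_Mapping.lookup y b) (W22_basis_bracket a b))"

abbreviation W22_L :: "int \<Rightarrow> W22" where
  "W22_L n \<equiv> Poly_Mapping.single (bL n) 1"

lemma lookup_W22_scale [simp]:
  "Poly_Mapping.lookup (W22_scale c x) a = c * Poly_Mapping.lookup x a"
  by (cases "Poly_Mapping.lookup x a = 0") (auto simp: W22_scale_def map.rep_eq when_def)

interpretation W22: vector_space W22_scale
  by unfold_locales (auto intro!: poly_mapping_eqI simp: lookup_add algebra_simps)

lemma W22_bracket_superset:
  assumes "finite A" "finite B" "Poly_Mapping.keys x \<subseteq> A" "Poly_Mapping.keys y \<subseteq> B"
  shows "W22_bracket x y =
     (\<Sum>a\<in>A. \<Sum>b\<in>B.
        W22_scale (Poly_Mapping.lookup x a * Poly_Mapping.lookup y b) (W22_basis_bracket a b))"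
proof -
  let ?f = "\<lambda>a b. W22_scale (Poly_Mapping.lookup x a * Poly_Mapping.lookup y b) (W22_basis_bracket a b)"
  have "W22_bracket x y = (\<Sum>a\<in>Poly_Mapping.keys x. \<Sum>b\<in>B. ?f a b)"
    unfolding W22_bracket_def
    by (intro sum.cong refl sum.mono_neutral_left assms) (auto simp: in_keys_iff)
  also have "\<dots> = (\<Sum>a\<in>A. \<Sum>b\<in>B. ?f a b)"
    by (intro sum.mono_neutral_left assms) (auto simp: in_keys_iff intro!: sum.neutral)
  finally show ?thesis .
qed

lemma W22_bracket_add_left: "W22_bracket (x + y) z = W22_bracket x z + W22_bracket y z"
proof -
  let ?A = "Poly_Mapping.keys x \<union> Poly_Mapping.keys y" and ?B = "Poly_Mapping.keys z"
  have k: "Poly_Mapping.keys (x + y) \<subseteq> ?A" by (rule keys_add)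
  show ?thesis
    using k by (subst (1 2 3) W22_bracket_superset[of ?A ?B])
      (auto simp: lookup_add W22.scale_left_distrib distrib_right sum.distrib)
qed

lemma W22_bracket_add_right: "W22_bracket z (x + y) = W22_bracket z x + W22_bracket z y"
proof -
  let ?A = "Poly_Mapping.keys x \<union> Poly_Mapping.keys y" and ?B = "Poly_Mapping.keys z"
  have k: "Poly_Mapping.keys (x + y) \<subseteq> ?A" by (rule keys_add)
  show ?thesis
    using k by (subst (1 2 3) W22_bracket_superset[of ?B ?A])
      (auto simp: lookup_add W22.scale_left_distrib distrib_left sum.distrib)
qed

lemma W22_keys_scale: "Poly_Mapping.keys (W22_scale c x) \<subseteq> Poly_Mapping.keys x"
  by (auto simp: in_keys_iff)

lemma W22_bracket_scale_left: "W22_bracket (W22_scale c x) z = W22_scale c (W22_bracket x z)"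
  by (subst (1 2) W22_bracket_superset[of "Poly_Mapping.keys x" "Poly_Mapping.keys z"])
    (use W22_keys_scale in \<open>auto simp: W22.scale_sum_right mult.assoc\<close>)

lemma W22_bracket_scale_right: "W22_bracket z (W22_scale c x) = W22_scale c (W22_bracket z x)"
  by (subst (1 2) W22_bracket_superset[of "Poly_Mapping.keys z" "Poly_Mapping.keys x"])
    (use W22_keys_scale in \<open>auto simp: W22.scale_sum_right ac_simps\<close>)

lemma W22_bracket_basis [simp]:
  "W22_bracket (Poly_Mapping.single a 1) (Poly_Mapping.single b 1) = W22_basis_bracket a b"
  by (simp add: W22_bracket_def)

lemma W22_scale_single [simp]:
  "W22_scale c (Poly_Mapping.single a d) = Poly_Mapping.single a (c * d)"
  by (auto intro!: poly_mapping_eqI simp: lookup_single when_def)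

lemma W22_bracket_single:
  "W22_bracket (Poly_Mapping.single a c) (Poly_Mapping.single b d) =
     W22_scale (c * d) (W22_basis_bracket a b)"
proof -
  have "Poly_Mapping.single a c = W22_scale c (Poly_Mapping.single a 1)"
    "Poly_Mapping.single b d = W22_scale d (Poly_Mapping.single b 1)" by simp_all
  then show ?thesis
    by (simp only: W22_bracket_scale_left W22_bracket_scale_right W22_bracket_basis
        W22.scale_scale mult.commute)
qed

lemma W22_bracket_zero [simp]: "W22_bracket 0 x = 0" "W22_bracket x 0 = 0"
  by (simp_all add: W22_bracket_def)

lemma W22_bracket_minus [simp]:
  "W22_bracket (- x) y = - W22_bracket x y" "W22_bracket x (- y) = - W22_bracket x y"
  using W22_bracket_scale_left[of "-1" x y] W22_bracket_scale_right[of x "-1" y]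
  by simp_all

lemma W22_expand:
  "x = (\<Sum>a\<in>Poly_Mapping.keys x. W22_scale (Poly_Mapping.lookup x a) (Poly_Mapping.single a 1))"
  by (auto intro!: poly_mapping_eqI
      simp: lookup_sum lookup_single when_def in_keys_iff sum.delta if_distrib cong: if_cong)

lemma W22_grade_induct [consumes 1, case_names zero basis add scale]:
  assumes x: "x \<in> W22_grade i"
    and "P 0"
    and "\<And>a. W22_parity a = i \<Longrightarrow> P (Poly_Mapping.single a 1)"
    and "\<And>x y. P x \<Longrightarrow> P y \<Longrightarrow> P (x + y)"
    and "\<And>c x. P x \<Longrightarrow> P (W22_scale c x)"
  shows "P x"
proof -
  have "P (\<Sum>a\<in>A. W22_scale (Poly_Mapping.lookup x a) (Poly_Mapping.single a 1))"
    if "finite A" "A \<subseteq> Poly_Mapping.keys x" for A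
    using that
  proof (induction A rule: finite_induct)
    case (insert a A)
    have "P (Poly_Mapping.single a 1)"
      using insert.prems x by (intro assms(3)) (auto simp: W22_grade_def)
    then show ?case
      unfolding sum.insert[OF insert.hyps] using insert by (intro assms(4) assms(5)) auto
  qed (simp add: assms(2))
  from this[of "Poly_Mapping.keys x"] show ?thesis by (subst W22_expand) simp
qed

lemma W22_induct [case_names zero basis add scale]:
  assumes "P 0"
    and "\<And>a. P (Poly_Mapping.single a 1)"
    and "\<And>x y. P x \<Longrightarrow> P y \<Longrightarrow> P (x + y)"
    and "\<And>c x. P x \<Longrightarrow> P (W22_scale c x)"
  shows "P x"
proof -
  have "P (\<Sum>a\<in>A. W22_scale (Poly_Mapping.lookup x a) (Poly_Mapping.single a 1))"
    if "finite A" for A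
    using that
  proof (induction A rule: finite_induct)
    case (insert a A)
    then show ?case
      unfolding sum.insert[OF insert.hyps] by (intro assms(3) assms(4) assms(2))
  qed (simp add: assms(1))
  from this[of "Poly_Mapping.keys x"] show ?thesis by (subst W22_expand) simp
qed

lemma W22_grade_subspace: "W22.subspace (W22_grade i)"
  unfolding W22.subspace_def W22_grade_def
  using keys_add W22_keys_scale by fastforce

lemma W22_grade_sum: "\<exists>x\<in>W22_grade 0. \<exists>y\<in>W22_grade 1. v = x + y"
proof (induction v rule: W22_induct)
  case zero
  show ?case by (intro bexI[of _ 0]) (auto simp: W22_grade_def)
next
  case (basis a)
  have "Poly_Mapping.single a 1 = Poly_Mapping.single a 1 + (0 :: W22)"
    "Poly_Mapping.single a 1 = (0 :: W22) + Poly_Mapping.single a 1" by simp_all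
  moreover have "Poly_Mapping.single a 1 \<in> W22_grade (W22_parity a)" "0 \<in> W22_grade i" for i
    by (simp_all add: W22_grade_def)
  ultimately show ?case by (cases "W22_parity a") metis+
next
  case (add x y)
  then obtain a b c d where
    "a \<in> W22_grade 0" "b \<in> W22_grade 1" "x = a + b" "c \<in> W22_grade 0" "d \<in> W22_grade 1" "y = c + d"
    by blast
  then show ?case
    by (intro bexI[of _ "a + c"] bexI[of _ "b + d"])
      (auto intro: W22.subspace_add[OF W22_grade_subspace])
next
  case (scale c x)
  then obtain a b where "a \<in> W22_grade 0" "b \<in> W22_grade 1" "x = a + b"
    by blast
  then show ?case
    by (intro bexI[of _ "W22_scale c a"] bexI[of _ "W22_scale c b"])
      (auto intro: W22.subspace_scale[OF W22_grade_subspace] simp: W22.scale_right_distrib)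
qed

lemma W22_basis_bracket_grade:
  "W22_basis_bracket a b \<in> W22_grade (W22_parity a + W22_parity b)"
  by (cases a; cases b) (auto simp: W22_grade_def)

lemma W22_basis_antisym:
  "W22_basis_bracket a b =
     - W22_scale (koszul (W22_parity a) (W22_parity b)) (W22_basis_bracket b a)"
  by (cases a; cases b)
    (auto simp: koszul_def add.commute single_uminus[symmetric] simp del: single_uminus)

lemma W22_basis_jacobi:
  "W22_bracket (Poly_Mapping.single a 1) (W22_basis_bracket b c) =
     W22_bracket (W22_basis_bracket a b) (Poly_Mapping.single c 1) +
     W22_scale (koszul (W22_parity a) (W22_parity b))
       (W22_bracket (Poly_Mapping.single b 1) (W22_basis_bracket a c))"
  by (cases a; cases b; cases c)
    (auto simp: koszul_def W22_bracket_single algebra_simps add_divide_distrib diff_divide_distrib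
      simp flip: single_uminus single_add single_diff
      intro!: poly_mapping_eqI)

interpretation W22: lie_superalgebra W22_scale W22_grade W22_bracket
proof unfold_locales
  show "W22.subspace (W22_grade i)" for i
    by (rule W22_grade_subspace)
  show "\<exists>x\<in>W22_grade 0. \<exists>y\<in>W22_grade 1. v = x + y" for v
    by (rule W22_grade_sum)
  show "W22_grade 0 \<inter> W22_grade 1 = {0}"
    by (auto simp: W22_grade_def)
  show "W22_bracket x y \<in> W22_grade (i + j)"
    if x: "x \<in> W22_grade i" and y: "y \<in> W22_grade j" for x y i j
    using x
  proof (induction rule: W22_grade_induct)
    case (basis a)
    show ?case
      using y
    proof (induction rule: W22_grade_induct)
      case (basis b)
      then show ?case
        using \<open>W22_parity a = i\<close> W22_basis_bracket_grade[of a b] by simp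
    qed (auto intro: W22.subspace_0 W22.subspace_add W22.subspace_scale
        simp: W22_grade_subspace W22_bracket_add_right W22_bracket_scale_right)
  qed (auto intro: W22.subspace_0 W22.subspace_add W22.subspace_scale
        simp: W22_grade_subspace W22_bracket_add_left W22_bracket_scale_left)
  show "W22_bracket x y = - W22_scale (koszul i j) (W22_bracket y x)"
    if x: "x \<in> W22_grade i" and y: "y \<in> W22_grade j" for x y i j
    using x
  proof (induction rule: W22_grade_induct)
    case (basis a)
    show ?case
      using y
    proof (induction rule: W22_grade_induct)
      case (basis b)
      then show ?case
        using \<open>W22_parity a = i\<close> W22_basis_antisym[of a b] by simp
    qed (simp_all add: W22_bracket_add_left W22_bracket_scale_left W22_bracket_add_right
        W22_bracket_scale_right W22.scale_right_distrib mult.commute)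
  qed (simp_all add: W22_bracket_add_left W22_bracket_scale_left W22_bracket_add_right
        W22_bracket_scale_right W22.scale_right_distrib mult.commute)
  show "W22_bracket x (W22_bracket y z) =
      W22_bracket (W22_bracket x y) z + W22_scale (koszul i j) (W22_bracket y (W22_bracket x z))"
    if x: "x \<in> W22_grade i" and y: "y \<in> W22_grade j" for x y z i j
    using x
  proof (induction rule: W22_grade_induct)
    case (basis a)
    show ?case
      using y
    proof (induction rule: W22_grade_induct)
      case (basis b)
      show ?case
      proof (induction z rule: W22_induct)
        case (basis c)
        then show ?case
          using \<open>W22_parity a = i\<close> \<open>W22_parity b = j\<close> W22_basis_jacobi[of a b c] by simp
      qed (simp_all add: W22_bracket_add_right
          W22_bracket_scale_right W22.scale_right_distrib mult.commute)
    qed (simp_all add: W22_bracket_add_left W22_bracket_scale_left W22_bracket_add_right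
        W22_bracket_scale_right W22.scale_right_distrib mult.commute)
  qed (simp_all add: W22_bracket_add_left W22_bracket_scale_left W22_bracket_add_right
        W22_bracket_scale_right W22.scale_right_distrib mult.commute)
qed (fact W22_bracket_add_left W22_bracket_add_right
      W22_bracket_scale_left W22_bracket_scale_right)+


section \<open>Weight modules\<close>

locale W22_module = lie_supermodule W22_scale W22_grade W22_bracket scale grade act
  for scale :: "complex \<Rightarrow> 'v::ab_group_add \<Rightarrow> 'v"
    and grade :: "bit \<Rightarrow> 'v set"
    and act :: "W22 \<Rightarrow> 'v \<Rightarrow> 'v"
begin

text \<open>The minus sign makes \<open>L\<^sub>n\<close> map \<open>M\<^sub>\<mu>\<close> to \<open>M\<^bsub>\<mu>+n\<^esub>\<close>.\<close>

definition weight_space :: "complex \<Rightarrow> 'v set" where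
  "weight_space \<mu> = {x. act (W22_L 0) x = - scale \<mu> x}"

text \<open>The module is the internal direct sum of its weight spaces: every vector is a finite sum of
  weight vectors in exactly one way.\<close>

definition weight_module :: bool where
  "weight_module \<longleftrightarrow>
     (\<forall>x. \<exists>!f. finite {\<mu>. f \<mu> \<noteq> 0} \<and> (\<forall>\<mu>. f \<mu> \<in> weight_space \<mu>)
        \<and> x = (\<Sum>\<mu> | f \<mu> \<noteq> 0. f \<mu>))"

definition weight_support :: "complex set" where
  "weight_support = {\<mu>. weight_space \<mu> \<noteq> {0}}"

end

end

theory Submission
  imports Defs
begin

text \<open>
  Suppose that \<open>M\<^bsub>\<nu>\<^esub>\<close> is infinite-dimensional and some \<open>M\<^bsub>\<nu>+k\<^esub>\<close> is not.  A nonzero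
  weight vector killed by all basis elements of degrees 1 and 2 would make \<open>M\<close> a highest weight
  module, whose weight spaces are finite-dimensional; so there is no such vector, and likewise none
  for degrees -1 and -2.  Hence finite-dimensional weight spaces are isolated: \<open>M\<^sub>0\<close> is
  finite-dimensional and \<open>M\<^sub>-\<^sub>1\<close>, \<open>M\<^sub>1\<close> are not, up to a shift of indices.
  Since \<open>M\<^sub>0\<close> is finite-dimensional, any finite set of elements of degree 1 of the enveloping
  algebra has a common zero \<open>v \<noteq> 0\<close> in \<open>M\<^sub>-\<^sub>1\<close>.  With sufficiently many such relations, repeated
  use of the absence of singular vectors produces from \<open>v\<close> a nonzero vector killed by all \<open>H\<^sub>n\<close>,
  then one killed by all \<open>I\<^sub>n\<close>, then one killed by all \<open>G\<^sub>n\<close>; by irreducibility these elements act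
  as zero and \<open>M\<close> is a module over the Witt algebra.  There the same relations force
  \<open>L\<^sub>m L\<^sub>n v = (1 - n) L\<^bsub>m+n\<^esub> v\<close> for all \<open>m\<close>, \<open>n\<close>, so the \<open>L\<^sub>n v\<close> span a submodule with
  weight spaces of dimension at most 1, a contradiction.
\<close>

section \<open>Linear algebra\<close>

text \<open>Containment in a finitely generated span, not equality with one, so that the notion
  passes to arbitrary subsets; on subspaces it is the negation of
  \<open>infinite_dimensional\<close>.\<close>

definition (in vector_space) finite_dim :: "'b set \<Rightarrow> bool" where
  "finite_dim S \<longleftrightarrow> (\<exists>B. finite B \<and> S \<subseteq> span B)"

context vector_space
begin

lemma infinite_dimensional_iff:
  assumes "subspace S"
  shows "infinite_dimensional S \<longleftrightarrow> \<not> finite_dim S"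
proof
  assume "infinite_dimensional S"
  show "\<not> finite_dim S"
  proof
    assume "finite_dim S"
    then obtain B where B: "finite B" "S \<subseteq> span B" by (auto simp: finite_dim_def)
    obtain C where C: "C \<subseteq> S" "independent C" "S \<subseteq> span C"
      by (rule maximal_independent_subset)
    have "finite C" using independent_span_bound[OF B(1) C(2)] C(1) B(2) by auto
    moreover have "span C = S"
      using C assms span_minimal[OF C(1) assms] by (intro equalityI)
    ultimately show False
      using \<open>infinite_dimensional S\<close> by (auto simp: infinite_dimensional_def)
  qed
qed (auto simp: infinite_dimensional_def finite_dim_def)

lemma finite_dim_subset: "finite_dim T \<Longrightarrow> S \<subseteq> T \<Longrightarrow> finite_dim S"
  by (auto simp: finite_dim_def)

lemma finite_dim_zero: "finite_dim {0}"
  by (auto simp: finite_dim_def intro!: exI[of _ "{}"])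

lemma finite_dim_span: "finite B \<Longrightarrow> finite_dim (span B)"
  by (auto simp: finite_dim_def)

lemma finite_dim_span_Union:
  assumes "finite A" "\<And>a. a \<in> A \<Longrightarrow> finite_dim (S a)"
  shows "finite_dim (span (\<Union>a\<in>A. S a))"
proof -
  obtain B where B: "\<And>a. a \<in> A \<Longrightarrow> finite (B a) \<and> S a \<subseteq> span (B a)"
    using assms(2) unfolding finite_dim_def by metis
  have "span (\<Union>a\<in>A. S a) \<subseteq> span (\<Union>a\<in>A. B a)"
  proof (rule span_minimal)
    show "(\<Union>a\<in>A. S a) \<subseteq> span (\<Union>a\<in>A. B a)"
    proof
      fix x assume "x \<in> (\<Union>a\<in>A. S a)"
      then obtain a where "a \<in> A" "x \<in> span (B a)" using B by auto
      then show "x \<in> span (\<Union>a\<in>A. B a)" using span_mono[of "B a" "\<Union>a\<in>A. B a"] by auto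
    qed
  qed simp
  moreover have "finite (\<Union>a\<in>A. B a)" using assms(1) B by auto
  ultimately show ?thesis unfolding finite_dim_def by blast
qed

lemma finite_dim_image:
  assumes "module_hom scale scale f" "finite_dim S"
  shows "finite_dim (f ` S)"
proof -
  interpret f: module_hom scale scale f by fact
  obtain B where "finite B" "S \<subseteq> span B" using assms(2) by (auto simp: finite_dim_def)
  then have "finite (f ` B)" "f ` S \<subseteq> span (f ` B)"
    by (auto simp: f.span_image)
  then show ?thesis unfolding finite_dim_def by blast
qed

text \<open>Rank-nullity: a finite spanning set of the kernel together with finitely many preimages
  of a basis of the image would span \<open>S\<close>.\<close>

lemma infinite_dim_kernel:
  assumes f: "module_hom scale scale f" and S: "subspace S" "\<not> finite_dim S"
    and fS: "finite_dim (f ` S)"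
  shows "\<not> finite_dim {x \<in> S. f x = 0}"
proof
  interpret f: module_hom scale scale f by fact
  assume "finite_dim {x \<in> S. f x = 0}"
  then obtain C where C: "finite C" "{x \<in> S. f x = 0} \<subseteq> span C" by (auto simp: finite_dim_def)
  obtain B where B: "finite B" "f ` S \<subseteq> span B" using fS by (auto simp: finite_dim_def)
  obtain D where D: "D \<subseteq> f ` S" "independent D" "f ` S \<subseteq> span D"
    by (rule maximal_independent_subset)
  have finD: "finite D" using independent_span_bound[OF B(1) D(2)] D(1) B(2) by auto
  obtain E where E: "E \<subseteq> S" "finite E" "D = f ` E"
    using finite_subset_image[OF finD D(1)] by auto
  have "S \<subseteq> span (C \<union> E)"
  proof
    fix x assume x: "x \<in> S"
    then have "f x \<in> f ` span E" using D(3) E(3) by (auto simp: f.span_image)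
    then obtain y where y: "y \<in> span E" "f x = f y" by auto
    have "y \<in> S" using y(1) span_minimal[OF E(1) S(1)] by auto
    then have "x - y \<in> span C" using C(2) x y(2) S(1) by (auto simp: f.diff subspace_diff)
    then have "x - y \<in> span (C \<union> E)" "y \<in> span (C \<union> E)"
      using y(1) span_mono[of C "C \<union> E"] span_mono[of E "C \<union> E"] by auto
    then have "(x - y) + y \<in> span (C \<union> E)" by (rule span_add)
    then show "x \<in> span (C \<union> E)" by simp
  qed
  moreover have "finite (C \<union> E)" using C(1) E(2) by simp
  ultimately show False using S(2) unfolding finite_dim_def by blast
qed

end

text \<open>Vector identities with many terms are reduced to identities between complex numbers by
  applying an arbitrary linear functional.\<close>

lemma vector_eqI:
  fixes scale :: "complex \<Rightarrow> 'v::ab_group_add \<Rightarrow> 'v"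
  assumes "vector_space scale"
    and eq: "\<And>\<phi>. module_hom scale (*) \<phi> \<Longrightarrow> \<phi> x = (\<phi> y :: complex)"
  shows "x = y"
proof (rule ccontr)
  interpret vector_space scale by fact
  interpret p: vector_space_pair scale "(*) :: complex \<Rightarrow> complex \<Rightarrow> complex"
    by unfold_locales (auto simp: algebra_simps)
  assume "x \<noteq> y"
  then have "independent {x - y}" by simp
  then obtain \<phi> where "Vector_Spaces.linear scale (*) \<phi>" "\<phi> (x - y) = 1"
    using p.linear_independent_extend[of "{x - y}" "\<lambda>_. 1"] by auto
  then have "module_hom scale (*) \<phi>" "\<phi> (x - y) = 1"
    by (simp_all add: linear_iff_module_hom)
  then show False using eq[of \<phi>] by (simp add: module_hom.diff)
qed

section \<open>Representations by operators\<close>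

fun deg :: "W22_basis \<Rightarrow> int" where
  "deg (bL n) = n"
| "deg (bI n) = n"
| "deg (bG n) = n"
| "deg (bH n) = n"

definition flip_basis :: "W22_basis \<Rightarrow> W22_basis" where
  "flip_basis b = (case b of bL n \<Rightarrow> bL (- n) | bI n \<Rightarrow> bI (- n) | bG n \<Rightarrow> bG (- n) | bH n \<Rightarrow> bH (- n))"

lemma deg_flip_basis [simp]: "deg (flip_basis b) = - deg b"
  by (cases b) (auto simp: flip_basis_def)

text \<open>\<open>X\<close> is the action of the basis letters and \<open>sg\<close> the parity
  involution, so graded submodules become \<open>sg\<close>-stable subspaces invariant under all
  \<open>X b\<close>. The brackets are kept as rules for reordering two letters.\<close>

locale W22_rep = vector_space scale
  for scale :: "complex \<Rightarrow> 'v::ab_group_add \<Rightarrow> 'v" +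
  fixes X :: "W22_basis \<Rightarrow> 'v \<Rightarrow> 'v" and sg :: "'v \<Rightarrow> 'v"
  assumes X_add: "X b (x + y) = X b x + X b y"
    and X_scale: "X b (scale r x) = scale r (X b x)"
    and sg_add: "sg (x + y) = sg x + sg y"
    and sg_scale: "sg (scale r x) = scale r (sg x)"
    and sg_sg: "sg (sg x) = x"
    and sg_X: "sg (X b x) = scale (if W22_parity b = 1 then -1 else 1) (X b (sg x))"
    and LL: "X (bL m) (X (bL n) x) =
      X (bL n) (X (bL m) x) + scale (of_int m - of_int n) (X (bL (m + n)) x)"
    and LI: "X (bL m) (X (bI n) x) =
      X (bI n) (X (bL m) x) + scale (of_int m - of_int n) (X (bI (m + n)) x)"
    and LG: "X (bL m) (X (bG n) x) =
      X (bG n) (X (bL m) x) + scale (of_int m / 2 - of_int n) (X (bG (m + n)) x)"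
    and LH: "X (bL m) (X (bH n) x) =
      X (bH n) (X (bL m) x) + scale (of_int m / 2 - of_int n) (X (bH (m + n)) x)"
    and GG: "X (bG m) (X (bG n) x) = - X (bG n) (X (bG m) x) + X (bI (m + n)) x"
    and IG: "X (bI m) (X (bG n) x) =
      X (bG n) (X (bI m) x) + scale (of_int m - 2 * of_int n) (X (bH (m + n)) x)"
    and II: "X (bI m) (X (bI n) x) = X (bI n) (X (bI m) x)"
    and IH: "X (bI m) (X (bH n) x) = X (bH n) (X (bI m) x)"
    and GH: "X (bG m) (X (bH n) x) = - X (bH n) (X (bG m) x)"
    and HH: "X (bH m) (X (bH n) x) = - X (bH n) (X (bH m) x)"
begin

lemmas vec_eqI = vector_eqI[OF vector_space_axioms]

lemma module_hom_X: "module_hom scale scale (X b)"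
  by unfold_locales (auto simp: X_add X_scale)

lemma module_hom_sg: "module_hom scale scale sg"
  by unfold_locales (auto simp: sg_add sg_scale)

lemma X_zero [simp]: "X b 0 = 0" and X_minus: "X b (- x) = - X b x"
  and X_diff: "X b (x - y) = X b x - X b y"
  using module_hom.zero[OF module_hom_X] module_hom.neg[OF module_hom_X]
    module_hom.diff[OF module_hom_X] by auto

lemma sg_zero [simp]: "sg 0 = 0" and sg_minus: "sg (- x) = - sg x"
  and sg_diff: "sg (x - y) = sg x - sg y"
  using module_hom.zero[OF module_hom_sg] module_hom.neg[OF module_hom_sg]
    module_hom.diff[OF module_hom_sg] by auto

lemmas X_lin = X_add X_scale X_minus X_diff

text \<open>The bracket of two basis letters is a multiple of a single letter, so reordering creates
  only one shorter word. Where the bracket vanishes, \<open>s\<close> is 0 and \<open>d\<close> is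
  any letter of the right degree.\<close>

lemma swap:
  "\<exists>e s d. (e = 1 \<or> e = -1) \<and> deg d = deg a + deg b \<and>
     (\<forall>x. X a (X b x) = scale e (X b (X a x)) + scale s (X d x))" (is "?P a b")
proof -
  have sym: "?P a b" if "?P b a" for a b
  proof -
    from that obtain e s d where e: "e = 1 \<or> e = -1" and d: "deg d = deg a + deg b"
      and eq: "\<And>x. X b (X a x) = scale e (X a (X b x)) + scale s (X d x)" by (auto simp: add.commute)
    have "X a (X b x) = scale e (X b (X a x)) + scale (- e * s) (X d x)" for x
      using e by (auto simp: eq scale_right_distrib)
    then show ?thesis using e d by blast
  qed
  have L: "?P (bL m) b" for m b
  proof (cases b)
    case (bL n)
    show ?thesis unfolding bL
      by (rule exI[of _ 1], rule exI[of _ "of_int m - of_int n"], rule exI[of _ "W22_basis.bL (m + n)"])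
        (use LL[of m n] in simp)
  next
    case (bI n)
    show ?thesis unfolding bI
      by (rule exI[of _ 1], rule exI[of _ "of_int m - of_int n"], rule exI[of _ "W22_basis.bI (m + n)"])
        (use LI[of m n] in simp)
  next
    case (bG n)
    show ?thesis unfolding bG
      by (rule exI[of _ 1], rule exI[of _ "of_int m / 2 - of_int n"],
          rule exI[of _ "W22_basis.bG (m + n)"]) (use LG[of m n] in simp)
  next
    case (bH n)
    show ?thesis unfolding bH
      by (rule exI[of _ 1], rule exI[of _ "of_int m / 2 - of_int n"],
          rule exI[of _ "W22_basis.bH (m + n)"]) (use LH[of m n] in simp)
  qed
  have I: "?P (bI m) (bI n)" "?P (bI m) (bH n)" for m n
    by (rule exI[of _ 1], rule exI[of _ 0], rule exI[of _ "W22_basis.bL (m + n)"],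
        use II[of m n] IH[of m n] in simp)+
  have H: "?P (bG m) (bH n)" "?P (bH m) (bH n)" for m n
    by (rule exI[of _ "-1"], rule exI[of _ 0], rule exI[of _ "W22_basis.bL (m + n)"],
        use GH[of m n] HH[of m n] in simp)+
  have G: "?P (bG m) (bG n)" for m n
    by (rule exI[of _ "-1"], rule exI[of _ 1], rule exI[of _ "W22_basis.bI (m + n)"])
      (use GG[of m n] in simp)
  have IG': "?P (bI m) (bG n)" for m n
    by (rule exI[of _ "1"], rule exI[of _ "of_int m - 2 * of_int n"],
        rule exI[of _ "W22_basis.bH (m + n)"]) (use IG[of m n] in simp)
  show ?thesis
    by (cases a; cases b; hypsubst;
        rule L sym[OF L] I sym[OF I(2)] H sym[OF H(1)] G IG' sym[OF IG'])
qed

definition wsp :: "complex \<Rightarrow> 'v set" where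
  "wsp \<nu> = {x. X (bL 0) x = scale (- \<nu>) x}"

lemma subspace_wsp: "subspace (wsp \<nu>)"
  by (auto simp: subspace_def wsp_def X_lin algebra_simps)

lemma X_wsp:
  assumes "x \<in> wsp \<nu>" "\<nu>' = \<nu> + of_int (deg b)"
  shows "X b x \<in> wsp \<nu>'"
proof -
  have "X (bL 0) (X b x) = X b (X (bL 0) x) - scale (of_int (deg b)) (X b x)"
    by (cases b) (use LL[of 0 _ x] LI[of 0 _ x] LG[of 0 _ x] LH[of 0 _ x] in simp_all)
  then show ?thesis using assms by (simp add: wsp_def X_lin algebra_simps)
qed

lemma sg_wsp: "x \<in> wsp \<nu> \<Longrightarrow> sg x \<in> wsp \<nu>"
  using sg_X[of "bL 0" x] by (simp add: wsp_def sg_scale sg_minus)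

lemma word_wsp:
  "x \<in> wsp \<nu> \<Longrightarrow> \<nu>' = \<nu> + of_int (sum_list (map deg ws)) \<Longrightarrow> foldr X ws x \<in> wsp \<nu>'"
proof (induction ws arbitrary: \<nu>')
  case (Cons b ws)
  show ?case
    using X_wsp[OF Cons.IH[OF Cons.prems(1) refl], of \<nu>' b] Cons.prems(2) by (simp add: algebra_simps)
qed simp

text \<open>The twist by an automorphism that reverses degrees; it turns statements about raising
  letters into statements about lowering letters. The sign on \<open>L\<close> comes from
  \<open>[L, L]\<close>; \<open>G\<close> may then keep its sign, which fixes \<open>+\<close> on
  \<open>I\<close> through \<open>[G, G]\<close> and \<open>-\<close> on \<open>H\<close> through
  \<open>[I, G]\<close>.\<close>

definition flip :: "W22_basis \<Rightarrow> 'v \<Rightarrow> 'v" where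
  "flip b x = (case b of bL n \<Rightarrow> - X (bL (- n)) x | bI n \<Rightarrow> X (bI (- n)) x
     | bG n \<Rightarrow> X (bG (- n)) x | bH n \<Rightarrow> - X (bH (- n)) x)"

lemma flip_X: "flip b x = X (flip_basis b) x \<or> flip b x = - X (flip_basis b) x"
  and X_flip: "X b x = flip (flip_basis b) x \<or> X b x = - flip (flip_basis b) x"
  by (cases b; simp add: flip_def flip_basis_def)+

lemma flip_W22_rep: "W22_rep scale flip sg"
proof unfold_locales
  fix m n :: int and x
  show "flip (bL m) (flip (bL n) x) =
      flip (bL n) (flip (bL m) x) + scale (of_int m - of_int n) (flip (bL (m + n)) x)"
    using LL[of "-m" "-n" x] by (simp add: flip_def X_minus scale_left_diff_distrib)
  show "flip (bL m) (flip (bI n) x) =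
      flip (bI n) (flip (bL m) x) + scale (of_int m - of_int n) (flip (bI (m + n)) x)"
    using LI[of "-m" "-n" x] by (simp add: flip_def X_minus scale_left_diff_distrib)
  show "flip (bL m) (flip (bG n) x) =
      flip (bG n) (flip (bL m) x) + scale (of_int m / 2 - of_int n) (flip (bG (m + n)) x)"
    using LG[of "-m" "-n" x] by (simp add: flip_def X_minus scale_left_diff_distrib scale_left_distrib)
  show "flip (bL m) (flip (bH n) x) =
      flip (bH n) (flip (bL m) x) + scale (of_int m / 2 - of_int n) (flip (bH (m + n)) x)"
    using LH[of "-m" "-n" x] by (simp add: flip_def X_minus scale_left_diff_distrib scale_left_distrib)
  show "flip (bG m) (flip (bG n) x) = - flip (bG n) (flip (bG m) x) + flip (bI (m + n)) x"
    using GG[of "-m" "-n" x] by (simp add: flip_def)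
  show "flip (bI m) (flip (bG n) x) =
      flip (bG n) (flip (bI m) x) + scale (of_int m - 2 * of_int n) (flip (bH (m + n)) x)"
    using IG[of "-m" "-n" x]
    by (simp add: flip_def X_minus scale_left_diff_distrib scale_left_distrib)
  show "flip (bI m) (flip (bI n) x) = flip (bI n) (flip (bI m) x)"
    using II[of "-m" "-n" x] by (simp add: flip_def)
  show "flip (bI m) (flip (bH n) x) = flip (bH n) (flip (bI m) x)"
    using IH[of "-m" "-n" x] by (simp add: flip_def X_minus)
  show "flip (bG m) (flip (bH n) x) = - flip (bH n) (flip (bG m) x)"
    using GH[of "-m" "-n" x] by (simp add: flip_def X_minus)
  show "flip (bH m) (flip (bH n) x) = - flip (bH n) (flip (bH m) x)"
    using HH[of "-m" "-n" x] by (simp add: flip_def X_minus)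
next
  fix b r x y
  show "flip b (x + y) = flip b x + flip b y" "flip b (scale r x) = scale r (flip b x)"
    by (cases b; simp add: flip_def X_lin)+
  show "sg (flip b x) = scale (if W22_parity b = 1 then -1 else 1) (flip b (sg x))"
    by (cases b) (simp_all add: flip_def sg_X sg_minus)
qed (auto simp: sg_add sg_scale sg_sg)

lemma flip_wsp: "W22_rep.wsp scale flip \<nu> = wsp (- \<nu>)"
proof -
  interpret f: W22_rep scale flip sg by (rule flip_W22_rep)
  show ?thesis by (auto simp: f.wsp_def wsp_def flip_def minus_equation_iff eq_commute)
qed

end

section \<open>Singular vectors\<close>

context W22_rep
begin

text \<open>For a top space \<open>T\<close>, these vectors span the part of the generated highest
  weight module that lies \<open>k\<close> degrees away from \<open>T\<close>.\<close>

definition words :: "'v set \<Rightarrow> int \<Rightarrow> 'v set" where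
  "words T k = {foldr X ws t |ws t.
     t \<in> T \<and> (\<forall>b\<in>set ws. deg b < 0) \<and> sum_list (map deg ws) = k}"

lemma words_Cons: "w \<in> words T k \<Longrightarrow> deg b < 0 \<Longrightarrow> X b w \<in> words T (k + deg b)"
  unfolding words_def by (force intro: exI[of _ "b # _"])

lemma span_words_Cons:
  assumes "y \<in> span (words T k)" "deg b < 0"
  shows "X b y \<in> span (words T (k + deg b))"
  using assms(1)
proof (induction rule: span_induct_alt)
  case (step c x y)
  then show ?case
    using words_Cons[OF _ assms(2), of x T k] by (simp add: X_lin span_add span_scale span_base)
qed (simp add: span_zero)

text \<open>Induction on the word: moving \<open>b\<close> past the first letter leaves a bracket
  term, a letter of arbitrary degree on a shorter word. Hence \<open>b\<close> is kept general, also
  among the lowering letters.\<close>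

lemma X_words:
  assumes T: "subspace T" "\<And>b t. t \<in> T \<Longrightarrow> deg b = 0 \<Longrightarrow> X b t \<in> T"
    "\<And>b t. t \<in> T \<Longrightarrow> deg b > 0 \<Longrightarrow> X b t = 0"
    and w: "w \<in> words T k"
  shows "X b w \<in> span (words T (k + deg b))"
proof -
  have "X b (foldr X ws t) \<in> span (words T (sum_list (map deg ws) + deg b))"
    if "t \<in> T" "\<forall>b\<in>set ws. deg b < 0" for ws t b
    using that(2)
  proof (induction ws arbitrary: b)
    case Nil
    have "X b t \<in> words T (deg b)" if "deg b = 0"
      using T(2)[OF \<open>t \<in> T\<close> that] that unfolding words_def by (force intro: exI[of _ "[]"])
    moreover have "X b t \<in> words T (deg b)" if "deg b < 0"
      using \<open>t \<in> T\<close> that unfolding words_def by (force intro: exI[of _ "[b]"])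
    moreover have "X b t = 0" if "deg b > 0" using T(3)[OF \<open>t \<in> T\<close> that] .
    ultimately show ?case by (cases "deg b" "0 :: int" rule: linorder_cases) (auto intro: span_base span_zero)
  next
    case (Cons a ws)
    let ?y = "foldr X ws t" and ?k = "sum_list (map deg ws)"
    obtain e s d where d: "deg d = deg b + deg a"
      and eq: "X b (X a ?y) = scale e (X a (X b ?y)) + scale s (X d ?y)"
      using swap[of b a] by blast
    have "X a (X b ?y) \<in> span (words T (?k + deg b + deg a))"
      using Cons by (intro span_words_Cons[of "X b ?y"]) auto
    moreover have "X d ?y \<in> span (words T (?k + deg d))" using Cons by auto
    ultimately have "X b (X a ?y) \<in> span (words T (?k + deg b + deg a))"
      unfolding eq using d by (intro span_add span_scale) (simp_all add: add.assoc)
    then show ?case by (simp add: ac_simps)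
  qed
  then show ?thesis using w unfolding words_def by auto
qed

lemma words_wsp:
  assumes "T \<subseteq> wsp \<nu>"
  shows "words T k \<subseteq> wsp (\<nu> + of_int k)"
  using assms word_wsp unfolding words_def by blast

lemma words_0: "words T 0 = T"
proof -
  have "ws = []" if "\<forall>b\<in>set ws. deg b < 0" "sum_list (map deg ws) = 0" for ws
  proof (cases ws)
    case (Cons b ws')
    have "sum_list (map deg ws') \<le> 0"
      using that(1) unfolding Cons by (intro sum_list_nonpos) auto
    then show ?thesis using that Cons by auto
  qed simp
  then show ?thesis unfolding words_def by (force intro: exI[of _ "[]"])
qed

lemma sg_word: "\<exists>e. e \<noteq> 0 \<and> sg (foldr X ws t) = scale e (foldr X ws (sg t))"
proof (induction ws)
  case Nil
  show ?case by (rule exI[of _ 1]) simp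
next
  case (Cons b ws)
  then obtain e where e: "e \<noteq> 0" "sg (foldr X ws t) = scale e (foldr X ws (sg t))" by blast
  let ?\<epsilon> = "if W22_parity b = 1 then -1 else 1 :: complex"
  have "sg (foldr X (b # ws) t) = scale (?\<epsilon> * e) (foldr X (b # ws) (sg t))"
    by (simp add: sg_X X_scale e)
  moreover have "?\<epsilon> * e \<noteq> 0" using e(1) by simp
  ultimately show ?case by blast
qed

text \<open>All degrees are at most -1, so a word has at most \<open>- k\<close> letters, each of
  degree at least \<open>k\<close>.\<close>

lemma finite_words: "finite {ws. (\<forall>b\<in>set ws. deg b < 0) \<and> sum_list (map deg ws) = k}"
proof (rule finite_subset)
  let ?B = "bL ` {k..0} \<union> bI ` {k..0} \<union> bG ` {k..0} \<union> bH ` {k..0}"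
  have "int (length ws) \<le> - sum_list (map deg ws) \<and> (\<forall>b\<in>set ws. sum_list (map deg ws) \<le> deg b)"
    if "\<forall>b\<in>set ws. deg b < 0" for ws
    using that
  proof (induction ws)
    case (Cons a ws)
    then show ?case by fastforce
  qed simp
  moreover have "b \<in> ?B" if "deg b \<ge> k" "deg b < 0" for b
    using that by (cases b) auto
  ultimately show "{ws. (\<forall>b\<in>set ws. deg b < 0) \<and> sum_list (map deg ws) = k} \<subseteq>
      {ws. set ws \<subseteq> ?B \<and> length ws \<le> nat (- k)}"
    by (smt (verit) Collect_mono nat_int nat_mono subsetI)
  show "finite {ws. set ws \<subseteq> ?B \<and> length ws \<le> nat (- k)}"
    by (rule finite_lists_length_le) simp
qed

lemma module_hom_word: "module_hom scale scale (foldr X ws)"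
proof (induction ws)
  case (Cons b ws)
  then interpret module_hom scale scale "foldr X ws" .
  show ?case by unfold_locales (simp_all add: X_add X_scale add scale)
next
  case Nil
  show ?case by unfold_locales simp_all
qed

lemma finite_dim_words:
  assumes "finite_dim T"
  shows "finite_dim (span (words T k))"
proof -
  let ?W = "{ws. (\<forall>b\<in>set ws. deg b < 0) \<and> sum_list (map deg ws) = k}"
  have "words T k = (\<Union>ws\<in>?W. foldr X ws ` T)"
    by (auto simp: words_def)
  then show ?thesis
    using finite_dim_span_Union[OF finite_words, of k "\<lambda>ws. foldr X ws ` T"]
      finite_dim_image[OF module_hom_word assms] by simp
qed

end

section \<open>Irreducible weight representations and their top spaces\<close>

locale W22_irr = W22_rep +
  assumes irr: "\<And>N. subspace N \<Longrightarrow> (\<And>b x. x \<in> N \<Longrightarrow> X b x \<in> N) \<Longrightarrow>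
      (\<And>x. x \<in> N \<Longrightarrow> sg x \<in> N) \<Longrightarrow> N = {0} \<or> N = UNIV"
    and proj: "\<And>\<nu>. \<exists>p. module_hom scale scale p \<and> (\<forall>x\<in>wsp \<nu>. p x = x) \<and>
      (\<forall>\<nu>' x. \<nu>' \<noteq> \<nu> \<longrightarrow> x \<in> wsp \<nu>' \<longrightarrow> p x = 0)"
begin

text \<open>The projections from \<open>proj\<close> encode directness of the weight decomposition:
  the one onto a given weight space removes all other terms of a linear combination of weight
  vectors.\<close>

lemma span_wsp:
  assumes W: "\<And>i. W i \<subseteq> wsp (\<nu> i)" "inj \<nu>"
    and x: "x \<in> span (\<Union>i. W i)"
  shows "x \<in> wsp (\<nu> m) \<Longrightarrow> x \<in> span (W m)"
    and "(\<And>i. \<nu> i \<noteq> \<nu>') \<Longrightarrow> x \<in> wsp \<nu>' \<Longrightarrow> x = 0"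
proof -
  obtain p where p: "module_hom scale scale p" "\<And>x. x \<in> wsp (\<nu> m) \<Longrightarrow> p x = x"
    "\<And>\<nu>' x. \<nu>' \<noteq> \<nu> m \<Longrightarrow> x \<in> wsp \<nu>' \<Longrightarrow> p x = 0"
    using proj[of "\<nu> m"] by blast
  interpret p: module_hom scale scale p by (rule p)
  have "p x \<in> span (W m)"
    using x
  proof (induction rule: span_induct_alt)
    case (step c x y)
    then obtain i where i: "x \<in> W i" by auto
    have "p x \<in> span (W m)"
    proof (cases "i = m")
      case True
      then show ?thesis using i W(1)[of m] p(2)[of x] span_base[of x "W m"] by auto
    next
      case False
      then have "p x = 0" using p(3)[of "\<nu> i"] i W injD[OF W(2)] by blast
      then show ?thesis by (simp add: span_zero)
    qed
    then show ?case using step by (simp add: p.add p.scale span_add span_scale)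
  qed (simp add: span_zero p.zero)
  then show "x \<in> wsp (\<nu> m) \<Longrightarrow> x \<in> span (W m)" using p(2) by simp
next
  assume \<nu>': "\<And>i. \<nu> i \<noteq> \<nu>'" "x \<in> wsp \<nu>'"
  obtain p where p: "module_hom scale scale p" "\<And>x. x \<in> wsp \<nu>' \<Longrightarrow> p x = x"
    "\<And>\<nu> x. \<nu> \<noteq> \<nu>' \<Longrightarrow> x \<in> wsp \<nu> \<Longrightarrow> p x = 0"
    using proj[of \<nu>'] by blast
  interpret p: module_hom scale scale p by (rule p)
  have "p x = 0"
    using x
  proof (induction rule: span_induct_alt)
    case (step c x y)
    then obtain i where "x \<in> W i" by auto
    then have "p x = 0" using p(3)[of "\<nu> i" x] W(1) \<nu>' by auto
    then show ?case using step by (simp add: p.add p.scale)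
  qed (simp add: p.zero)
  then show "x = 0" using p(2)[OF \<nu>'(2)] by simp
qed

lemma words_UNIV:
  assumes T: "subspace T" "\<And>b t. t \<in> T \<Longrightarrow> deg b = 0 \<Longrightarrow> X b t \<in> T"
    "\<And>b t. t \<in> T \<Longrightarrow> deg b > 0 \<Longrightarrow> X b t = 0"
    and sgT: "\<And>t. t \<in> T \<Longrightarrow> sg t \<in> T" and "T \<noteq> {0}"
  shows "span (\<Union>k. words T k) = UNIV"
proof -
  let ?N = "span (\<Union>k. words T k)"
  have "?N = {0} \<or> ?N = UNIV"
  proof (rule irr)
    fix b x assume "x \<in> ?N"
    then show "X b x \<in> ?N"
    proof (induction rule: span_induct_alt)
      case (step c x y)
      then obtain k where "x \<in> words T k" by auto
      from X_words[OF T this, of b] have "X b x \<in> ?N"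
        using span_mono[of "words T (k + deg b)" "\<Union>k. words T k"] by auto
      then show ?case using step by (simp add: X_lin span_add span_scale)
    qed (simp add: span_zero)
  next
    fix x assume "x \<in> ?N"
    then show "sg x \<in> ?N"
    proof (induction rule: span_induct_alt)
      case (step c x y)
      then obtain k ws t where x: "x = foldr X ws t" "t \<in> T" "\<forall>b\<in>set ws. deg b < 0"
        unfolding words_def by auto
      obtain e where e: "sg x = scale e (foldr X ws (sg t))" using sg_word[of ws t] x(1) by auto
      have "foldr X ws (sg t) \<in> (\<Union>k. words T k)"
        unfolding words_def using sgT[OF x(2)] x(3) by auto
      then show ?case using step by (simp add: sg_add sg_scale e span_add span_scale span_base)
    qed (simp add: span_zero)
  qed simp
  moreover have "T \<subseteq> ?N" using words_0[of T] by (metis UN_upper UNIV_I order_trans span_superset)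
  moreover have "0 \<in> T" using T(1) by (rule subspace_0)
  ultimately show ?thesis using \<open>T \<noteq> {0}\<close> by auto
qed

text \<open>By irreducibility the words on \<open>T\<close> span everything. Comparing weights, only
  the empty word contributes to weight \<nu>, and every other weight space is reached by finitely
  many words.\<close>

lemma top_space:
  assumes T: "subspace T" "\<And>b t. t \<in> T \<Longrightarrow> deg b = 0 \<Longrightarrow> X b t \<in> T"
    "\<And>b t. t \<in> T \<Longrightarrow> deg b > 0 \<Longrightarrow> X b t = 0"
    and sgT: "\<And>t. t \<in> T \<Longrightarrow> sg t \<in> T" and "T \<noteq> {0}" and Tw: "T \<subseteq> wsp \<nu>"
  shows "wsp \<nu> \<subseteq> T" and "finite_dim T \<Longrightarrow> finite_dim (wsp \<nu>')"
proof -
  note U = words_UNIV[OF T sgT \<open>T \<noteq> {0}\<close>]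
  have inj: "inj (\<lambda>k :: int. \<nu> + of_int k)" by (auto simp: inj_def)
  note W = span_wsp[OF words_wsp[OF Tw] inj]
  show "wsp \<nu> \<subseteq> T"
    using W(1)[of _ 0] U words_0[of T] span_eq_iff[THEN iffD2, OF T(1)] by auto
  assume fin: "finite_dim T"
  show "finite_dim (wsp \<nu>')"
  proof (cases "\<exists>k::int. \<nu>' = \<nu> + of_int k")
    case True
    then obtain k :: int where "\<nu>' = \<nu> + of_int k" by auto
    then have "wsp \<nu>' \<subseteq> span (words T k)" using W(1)[of _ k] U by auto
    then show ?thesis using finite_dim_words[OF fin] finite_dim_subset by blast
  next
    case False
    then have "wsp \<nu>' \<subseteq> {0}" using W(2)[of _ \<nu>'] U by auto
    then show ?thesis using finite_dim_zero finite_dim_subset by blast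
  qed
qed

end

section \<open>Singular vectors generate modules with finite-dimensional weight spaces\<close>

lemma one_minus_of_int_neq_0: "n \<noteq> 1 \<Longrightarrow> (1 :: complex) - of_int n \<noteq> 0"
  by (metis eq_iff_diff_eq_0 of_int_eq_1_iff)

lemma half_minus_of_int_neq_0: "(1 / 2 :: complex) - of_int n \<noteq> 0"
proof
  assume "(1 / 2 :: complex) - of_int n = 0"
  then have "of_int 1 = (of_int (2 * n) :: complex)" by (simp add: mult.commute)
  then show False unfolding of_int_eq_iff by presburger
qed

context W22_rep
begin

lemma raise_L: "X (bL 1) z = 0 \<Longrightarrow> X (bL n) z = 0 \<Longrightarrow> n \<noteq> 1 \<Longrightarrow> X (bL (1 + n)) z = 0"
  using LL[of 1 n z] one_minus_of_int_neq_0[of n] by simp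

lemma raise_I: "X (bL 1) z = 0 \<Longrightarrow> X (bI n) z = 0 \<Longrightarrow> n \<noteq> 1 \<Longrightarrow> X (bI (1 + n)) z = 0"
  using LI[of 1 n z] one_minus_of_int_neq_0[of n] by simp

lemma raise_G: "X (bL 1) z = 0 \<Longrightarrow> X (bG n) z = 0 \<Longrightarrow> X (bG (1 + n)) z = 0"
  using LG[of 1 n z] half_minus_of_int_neq_0[of n] by simp

lemma raise_H: "X (bL 1) z = 0 \<Longrightarrow> X (bH n) z = 0 \<Longrightarrow> X (bH (1 + n)) z = 0"
  using LH[of 1 n z] half_minus_of_int_neq_0[of n] by simp

text \<open>Bracketing with \<open>L_1\<close> raises the index by one, with factor
  \<open>1 - n\<close> for \<open>L\<close> and \<open>I\<close> and \<open>1/2 - n\<close> for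
  \<open>G\<close> and \<open>H\<close>. The factor vanishes only at \<open>n = 1\<close> for
  \<open>L\<close> and \<open>I\<close>, which is why degree 2 is assumed as well.\<close>

lemma positive_letters:
  assumes z: "\<And>b. deg b = 1 \<or> deg b = 2 \<Longrightarrow> X b z = 0" and "deg b > 0"
  shows "X b z = 0"
proof -
  have L1: "X (bL 1) z = 0" using z by simp
  have 1: "X (bL n) z = 0" "X (bI n) z = 0" if "n \<ge> 2" for n
    using that
  proof (induction n rule: int_ge_induct)
    case (step n)
    then have "n \<noteq> 1" by simp
    { case 1 show ?case using raise_L[OF L1 step.IH(1) \<open>n \<noteq> 1\<close>] by (simp only: add.commute) }
    { case 2 show ?case using raise_I[OF L1 step.IH(2) \<open>n \<noteq> 1\<close>] by (simp only: add.commute) }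
  qed (use z in simp_all)
  have 2: "X (bG n) z = 0" "X (bH n) z = 0" if "n \<ge> 1" for n
    using that
  proof (induction n rule: int_ge_induct)
    case (step n)
    { case 1 show ?case using raise_G[OF L1 step.IH(1)] by (simp only: add.commute) }
    { case 2 show ?case using raise_H[OF L1 step.IH(2)] by (simp only: add.commute) }
  qed (use z in simp_all)
  show ?thesis
  proof (cases "deg b = 1")
    case False
    then show ?thesis using assms(2) by (cases b) (use 1 2 in auto)
  qed (use z in auto)
qed

definition singular :: "complex \<Rightarrow> 'v \<Rightarrow> bool" where
  "singular \<nu> z \<longleftrightarrow> z \<in> wsp \<nu> \<and> (\<forall>b. deg b > 0 \<longrightarrow> X b z = 0)"

lemma subspace_singular: "subspace {z. singular \<nu> z}"
  using subspace_wsp[of \<nu>] by (auto simp: subspace_def singular_def X_lin)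

lemma singular_X: "singular \<nu> z \<Longrightarrow> deg a = 0 \<Longrightarrow> singular \<nu> (X a z)"
  unfolding singular_def
proof (intro conjI allI impI)
  fix b assume z: "z \<in> wsp \<nu> \<and> (\<forall>b. 0 < deg b \<longrightarrow> X b z = 0)" and a: "deg a = 0" and b: "deg b > 0"
  obtain e s d where "deg d = deg b + deg a"
      "X b (X a z) = scale e (X a (X b z)) + scale s (X d z)"
      using swap[of b a] by blast
  then show "X b (X a z) = 0" using z a b by simp
qed (auto intro: X_wsp)

lemma singular_sg:
  assumes "singular \<nu> z"
  shows "singular \<nu> (sg z)"
proof -
  have "X b (sg z) = 0" if "deg b > 0" for b
    using assms that sg_X[of b z] by (auto simp: singular_def split: if_splits)
  then show ?thesis using assms by (auto simp: singular_def sg_wsp)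
qed

text \<open>The vectors \<open>x + sg x\<close> and \<open>x - sg x\<close> are homogeneous and add
  up to \<open>2 x\<close>, so they are not both zero.\<close>

lemma homogeneous_element:
  assumes "subspace S" "\<And>x. x \<in> S \<Longrightarrow> sg x \<in> S" "x \<in> S" "x \<noteq> 0"
  obtains z \<epsilon> where "z \<in> S" "z \<noteq> 0" "sg z = scale \<epsilon> z"
proof -
  have "x + sg x \<in> S" "x - sg x \<in> S"
    using assms(1-3) by (auto intro: subspace_add subspace_diff)
  moreover have "sg (x + sg x) = scale 1 (x + sg x)" "sg (x - sg x) = scale (-1) (x - sg x)"
    by (simp_all add: sg_add sg_diff sg_sg add.commute)
  moreover have "x + sg x \<noteq> 0 \<or> x - sg x \<noteq> 0"
  proof (rule ccontr)
    assume "\<not> ?thesis"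
    then have "scale 2 x = (x + sg x) + (x - sg x)" "x + sg x = 0" "x - sg x = 0"
      using scale_left_distrib[of 1 1 x] by auto
    then show False using \<open>x \<noteq> 0\<close> by auto
  qed
  ultimately show ?thesis using that by blast
qed

end

text \<open>The top of the module is cyclic under \<open>G\<^sub>0\<close> once \<open>H\<^sub>0\<close> kills the generator, because
  \<open>I\<^sub>0 = 2 G\<^sub>0\<^sup>2\<close>.  It is finite-dimensional: \<open>G\<^sub>0\<^sup>2 z\<close> is zero or generates everything, and then
  \<open>z\<close> is a combination of the \<open>G\<^sub>0\<^sup>j z\<close> with \<open>j \<ge> 2\<close>.\<close>

lemma (in W22_irr) singular_imp_finite_dim:
  assumes "singular \<nu> z" "z \<noteq> 0"
  shows "finite_dim (wsp \<nu>')"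
proof -
  obtain z1 \<epsilon>1 where z1: "singular \<nu> z1" "z1 \<noteq> 0" "sg z1 = scale \<epsilon>1 z1"
    using homogeneous_element[OF subspace_singular[of \<nu>], of z] singular_sg assms by auto
  \<comment> \<open>Since \<open>H_0\<close> squares to zero, either \<open>z1\<close> or
    \<open>H_0 z1\<close> is a nonzero singular vector killed by \<open>H_0\<close>.\<close>
  obtain y \<epsilon> where y: "singular \<nu> y" "y \<noteq> 0" "sg y = scale \<epsilon> y" "X (bH 0) y = 0"
  proof (cases "X (bH 0) z1 = 0")
    case False
    have "X (bH 0) (X (bH 0) z1) = 0"
      using HH[of 0 0 z1] by (metis add_eq_0_iff2 scale_eq_0_iff scale_left_distrib scale_one
          one_add_one zero_neq_numeral)
    then show ?thesis
      using that[of "X (bH 0) z1" "- \<epsilon>1"] z1 False singular_X[OF z1(1), of "bH 0"]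
      by (simp add: sg_X X_scale)
  qed (use that z1 in blast)
  define g where "g j = (X (bG 0) ^^ j) y" for j
  have g0: "g 0 = y" and gS: "g (Suc j) = X (bG 0) (g j)" for j by (auto simp: g_def)
  have sing: "singular \<nu> (g j)" for j
    by (induction j) (auto simp: g0 gS y intro: singular_X)
  have H: "X (bH 0) (g j) = 0" for j
  proof (induction j)
    case (Suc j)
    then show ?case using GH[of 0 0 "g j"] by (simp add: gS)
  qed (simp add: g0 y)
  have I: "X (bI 0) (g j) = scale 2 (g (Suc (Suc j)))" for j
    using GG[of 0 0 "g j"] scale_left_distrib[of 1 1 "g (Suc (Suc j))"]
    by (simp add: gS eq_diff_eq)
  have sgg: "\<exists>e. sg (g j) = scale e (g j)" for j
  proof (induction j)
    case (Suc j)
    then obtain e where "sg (g j) = scale e (g j)" by blast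
    then have "sg (g (Suc j)) = scale (- e) (g (Suc j))" by (simp add: gS sg_X X_scale)
    then show ?case by blast
  qed (use y(3) g0 in auto)
  \<comment> \<open>Every tail \<open>T k\<close> is stable under degree 0: \<open>L_0\<close> is a
    scalar, \<open>G_0\<close> shifts \<open>g\<close> by one, \<open>I_0\<close> shifts it by two
    up to a factor 2, and \<open>H_0\<close> vanishes. So each nonzero tail is a top space.\<close>
  define T where "T k = span (g ` {k..})" for k
  have T_induct: "P (X a x)"
    if "x \<in> T k" "P 0" "\<And>c x y. P x \<Longrightarrow> P y \<Longrightarrow> P (scale c x + y)" "\<And>j. j \<ge> k \<Longrightarrow> P (X a (g j))" for P a x k
    using that(1) unfolding T_def
    by (induction rule: span_induct_alt) (use that(2,3,4) in \<open>auto simp: X_lin\<close>)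
  have gT: "g j \<in> T k" if "j \<ge> k" for j k using that by (auto simp: T_def intro: span_base)
  have T1: "subspace (T k)" for k by (simp add: T_def)
  have T2: "X a x \<in> T k" if "x \<in> T k" "deg a = 0" for a x k
  proof (rule T_induct[OF that(1)])
    fix j assume "j \<ge> k"
    have L: "X (bL 0) (g j) = scale (- \<nu>) (g j)" using sing[of j] by (simp add: singular_def wsp_def)
    have "scale r (g j) \<in> T k" "scale r (g (Suc j)) \<in> T k" "scale r (g (Suc (Suc j))) \<in> T k" for r
      using \<open>j \<ge> k\<close> by (auto intro!: subspace_scale T1 gT)
    from this(1)[of "- \<nu>"] this(2)[of 1] this(3)[of 2] show "X a (g j) \<in> T k"
      using that(2) subspace_0[OF T1] by (cases a) (simp_all add: L H I gS del: scale_minus_left)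
  qed (use T1 in \<open>auto intro!: subspace_0 subspace_add subspace_scale\<close>)
  have T3: "X a x = 0" if "x \<in> T k" "deg a > 0" for a x k
    by (rule T_induct[OF that(1)]) (use sing that(2) in \<open>auto simp: singular_def\<close>)
  have T4: "sg x \<in> T k" if "x \<in> T k" for x k
    using that unfolding T_def
  proof (induction rule: span_induct_alt)
    case (step c x w)
    then obtain j where j: "j \<ge> k" "x = g j" by auto
    obtain e where "sg x = scale e x" using sgg[of j] j by auto
    then show ?case using step by (simp add: sg_add sg_scale span_add span_scale span_base)
  qed (simp add: span_zero)
  have T5: "T k \<subseteq> wsp \<nu>" for k
    unfolding T_def by (rule span_minimal) (use sing in \<open>auto simp: singular_def subspace_wsp\<close>)
  have "T 0 \<noteq> {0}" using gT[of 0 0] y(2) g0 by auto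
  then have T0: "finite_dim (T 0) \<Longrightarrow> finite_dim (wsp \<nu>')"
    by (intro top_space(2)[OF T1 T2 T3 T4 _ T5]) auto
  have "finite_dim (T 0)"
  proof (cases "g 2 = 0")
    case True
    have zero: "g j = 0" if "j \<ge> 2" for j
      using that by (induction j rule: dec_induct) (simp_all add: True gS)
    then have "g ` {0..} \<subseteq> span (g ` {0, 1})"
    proof (intro image_subsetI)
      fix j
      show "g j \<in> span (g ` {0, 1})"
      proof (cases "j \<ge> 2")
        case False
        then have "j = 0 \<or> j = 1" by auto
        then show ?thesis by (auto intro: span_base)
      qed (simp add: zero span_zero)
    qed
    then have "T 0 \<subseteq> span (g ` {0, 1})" unfolding T_def by (intro span_minimal) auto
    then show ?thesis by (rule finite_dim_subset[OF finite_dim_span, rotated]) simp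
  next
    case False
    then have "T 2 \<noteq> {0}" using gT[of 2 2] by auto
    from top_space(1)[OF T1 T2 T3[where k = 2] T4 this T5] have "y \<in> T 2"
      using y(1) by (auto simp: singular_def)
    then obtain S where S: "finite S" "S \<subseteq> g ` {2..}" "y \<in> span S"
      unfolding T_def span_explicit by (auto simp: span_explicit)
    then obtain A where A: "A \<subseteq> {2..}" "finite A" "S = g ` A"
      using finite_subset_image[OF S(1,2)] by auto
    have "A \<subseteq> {2..<Suc (Max (insert 0 A))}"
      using A(1,2) by (auto simp: less_Suc_eq_le intro!: Max_ge)
    then have "S \<subseteq> g ` {2..<Suc (Max (insert 0 A))}" using A(3) by (simp add: image_mono)
    then have ex: "\<exists>m. y \<in> span (g ` {2..<m})" using S(3) span_mono by blast
    \<comment> \<open>By minimality of \<open>m = n + 1\<close> the coefficient of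
      \<open>g n\<close> in an expression of \<open>y\<close> is nonzero. As \<open>y = g 0\<close>,
      this makes \<open>g n\<close> a combination of \<open>g 0\<close>, ...,
      \<open>g (n - 1)\<close>, whose span is then stable under \<open>G_0\<close>.\<close>
    define m where "m = (LEAST m. y \<in> span (g ` {2..<m}))"
    have m: "y \<in> span (g ` {2..<m})" "\<And>n. n < m \<Longrightarrow> y \<notin> span (g ` {2..<n})"
      unfolding m_def using LeastI_ex[OF ex] not_less_Least by auto
    have "m > 2" using m(1) y(2) by (cases "m > 2") auto
    then obtain n where n: "m = Suc n" "n \<ge> 2" by (cases m) auto
    have "{2..<m} = insert n {2..<n}" using n by auto
    then obtain k where k: "y - scale k (g n) \<in> span (g ` {2..<n})"
      using m(1) by (auto simp: span_breakdown_eq)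
    let ?V = "span (g ` {..<n})"
    have "k \<noteq> 0" using k m(2)[of n] n by auto
    have "y \<in> ?V" using g0 n by (intro span_base) (auto intro!: image_eqI[of _ _ 0])
    moreover have "y - scale k (g n) \<in> ?V"
      by (rule subsetD[OF span_mono[OF image_mono] k]) auto
    ultimately have "y - (y - scale k (g n)) \<in> ?V" by (rule span_diff)
    then have "scale k (g n) \<in> ?V" by simp
    then have gn: "g n \<in> ?V" using span_scale[of "scale k (g n)" _ "inverse k"] \<open>k \<noteq> 0\<close> by simp
    have step: "X (bG 0) x \<in> ?V" if "x \<in> ?V" for x
      using that
    proof (induction rule: span_induct_alt)
      case (step c x w)
      then obtain j where j: "x = g j" "j < n" by auto
      then have "X (bG 0) x = g (Suc j)" by (simp add: gS)
      then have "X (bG 0) x \<in> ?V" using gn j(2) by (cases "Suc j = n") (auto intro: span_base)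
      then show ?case using step by (simp add: X_lin span_add span_scale)
    qed (simp add: span_zero)
    have "g j \<in> ?V" for j
      by (induction j) (use \<open>y \<in> ?V\<close> step in \<open>simp_all add: g0 gS\<close>)
    then have "T 0 \<subseteq> ?V" unfolding T_def by (intro span_minimal) auto
    then show ?thesis by (rule finite_dim_subset[OF finite_dim_span, rotated]) simp
  qed
  then show ?thesis by (rule T0)
qed

lemma (in W22_irr) flip_W22_irr: "W22_irr scale flip sg"
proof -
  interpret f: W22_rep scale flip sg by (rule flip_W22_rep)
  show ?thesis
  proof unfold_locales
    fix N
    assume N: "subspace N" "\<And>b x. x \<in> N \<Longrightarrow> flip b x \<in> N" "\<And>x. x \<in> N \<Longrightarrow> sg x \<in> N"
    have "X b x \<in> N" if "x \<in> N" for b x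
      using X_flip[of b x] N(2)[OF that] subspace_neg[OF N(1)] by metis
    then show "N = {0} \<or> N = UNIV" by (rule irr[OF N(1) _ N(3)])
  next
    fix \<nu>
    obtain p where p: "module_hom scale scale p" "\<forall>x\<in>wsp (- \<nu>). p x = x"
      "\<forall>\<nu>' x. \<nu>' \<noteq> - \<nu> \<longrightarrow> x \<in> wsp \<nu>' \<longrightarrow> p x = 0"
      using proj[of "- \<nu>"] by blast
    then show "\<exists>p. module_hom scale scale p \<and> (\<forall>x\<in>f.wsp \<nu>. p x = x) \<and>
          (\<forall>\<nu>' x. \<nu>' \<noteq> \<nu> \<longrightarrow> x \<in> f.wsp \<nu>' \<longrightarrow> p x = 0)"
      unfolding flip_wsp by (intro exI[of _ p]) (metis neg_equal_iff_equal)
  qed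
qed

section \<open>Absence of singular vectors\<close>

locale W22_inf = W22_irr +
  assumes inf: "\<exists>\<nu>. \<not> finite_dim (wsp \<nu>)"
begin

lemma no_singular_up:
  assumes "z \<in> wsp \<nu>" "\<And>b. deg b = 1 \<or> deg b = 2 \<Longrightarrow> X b z = 0"
  shows "z = 0"
  using singular_imp_finite_dim[of \<nu> z] positive_letters[OF assms(2)] assms(1) inf
  by (auto simp: singular_def)

lemma flip_W22_inf: "W22_inf scale flip sg"
proof -
  interpret f: W22_irr scale flip sg by (rule flip_W22_irr)
  obtain \<nu> where "\<not> finite_dim (f.wsp (- \<nu>))" using inf by (auto simp: flip_wsp)
  then show ?thesis by unfold_locales blast
qed

lemma no_singular_down:
  assumes "z \<in> wsp \<nu>" "\<And>b. deg b = -1 \<or> deg b = -2 \<Longrightarrow> X b z = 0"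
  shows "z = 0"
proof -
  interpret f: W22_inf scale flip sg by (rule flip_W22_inf)
  show ?thesis
  proof (rule f.no_singular_up[of z "- \<nu>"])
    fix b assume "deg b = 1 \<or> deg b = 2"
    then have "X (flip_basis b) z = 0" using assms(2)[of "flip_basis b"] by auto
    then show "flip b z = 0" using flip_X[of b z] by auto
  qed (use assms(1) in \<open>simp add: flip_wsp\<close>)
qed

end

section \<open>Vectors next to a finite-dimensional weight space\<close>

text \<open>Each word maps into a finite-dimensional space, so passing to its kernel keeps the
  dimension infinite; do this for one word after the other.\<close>

lemma (in W22_rep) common_zero:
  assumes "\<not> finite_dim (wsp \<nu>)" "finite F"
    and F: "\<And>ws. ws \<in> F \<Longrightarrow> finite_dim (wsp (\<nu> + of_int (sum_list (map deg ws))))"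
  obtains v where "v \<noteq> 0" "v \<in> wsp \<nu>" "\<And>ws. ws \<in> F \<Longrightarrow> foldr X ws v = 0"
proof -
  let ?S = "\<lambda>F. {v \<in> wsp \<nu>. \<forall>ws\<in>F. foldr X ws v = 0}"
  have sub: "subspace (?S F)" for F
    using subspace_wsp[of \<nu>] module_hom.add[OF module_hom_word] module_hom.scale[OF module_hom_word]
      module_hom.zero[OF module_hom_word]
    by (auto simp: subspace_def)
  have "\<not> finite_dim (?S F)"
    using \<open>finite F\<close> F
  proof (induction F rule: finite_induct)
    case empty
    then show ?case using assms(1) by simp
  next
    case (insert ws F)
    have "finite_dim (foldr X ws ` ?S F)"
      using word_wsp[OF _ refl, of _ \<nu> ws]
      by (intro finite_dim_subset[OF insert.prems[of ws]]) auto
    from infinite_dim_kernel[OF module_hom_word sub _ this] insert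
    have "\<not> finite_dim {x \<in> ?S F. foldr X ws x = 0}" by auto
    moreover have "{x \<in> ?S F. foldr X ws x = 0} = ?S (insert ws F)" by auto
    ultimately show ?case by simp
  qed
  then have "\<not> ?S F \<subseteq> {0}" using finite_dim_zero finite_dim_subset by blast
  then show ?thesis using that by blast
qed

lemma finite_bounded_letters: "finite {b. \<bar>deg b\<bar> \<le> n}"
proof (rule finite_subset)
  show "{b. \<bar>deg b\<bar> \<le> n} \<subseteq> bL ` {-n..n} \<union> bI ` {-n..n} \<union> bG ` {-n..n} \<union> bH ` {-n..n}" (is "_ \<subseteq> ?B")
  proof
    fix b assume "b \<in> {b. \<bar>deg b\<bar> \<le> n}"
    then show "b \<in> ?B" by (cases b) (auto simp: image_iff)
  qed
qed simp

locale W22_gap = W22_inf +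
  fixes \<nu>0 :: complex
  assumes gap: "finite_dim (wsp \<nu>0)" "\<not> finite_dim (wsp (\<nu>0 - 1))" "\<not> finite_dim (wsp (\<nu>0 + 1))"
begin

text \<open>The eigenvalue of \<open>L_0\<close> on \<open>wsp (\<nu>0 - 1)\<close>.\<close>

definition c :: complex where "c = 1 - \<nu>0"

text \<open>A bounded amount of information about \<open>wsp (\<nu>0 - 1)\<close> modulo subspaces of finite codimension:
  a word of degree 1 maps this space to the finite-dimensional \<open>wsp \<nu>0\<close>, so finitely many such
  words have a common zero.  The bound 6 on the letters exceeds what is used below.\<close>

definition good :: "nat \<Rightarrow> 'a \<Rightarrow> bool" where
  "good d v \<longleftrightarrow> v \<in> wsp (\<nu>0 - 1) \<and> (\<forall>ws. length ws \<le> d \<longrightarrow> (\<forall>b\<in>set ws. \<bar>deg b\<bar> \<le> 6) \<longrightarrow>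
     sum_list (map deg ws) = 1 \<longrightarrow> foldr X ws v = 0)"

lemma ex_good: "\<exists>v. v \<noteq> 0 \<and> good d v"
proof -
  let ?F = "{ws. (set ws \<subseteq> {b. \<bar>deg b\<bar> \<le> 6} \<and> length ws \<le> d) \<and> sum_list (map deg ws) = 1}"
  have "finite ?F"
    by (rule finite_subset[OF _ finite_lists_length_le[OF finite_bounded_letters]]) auto
  then obtain v where "v \<noteq> 0" "v \<in> wsp (\<nu>0 - 1)" "\<And>ws. ws \<in> ?F \<Longrightarrow> foldr X ws v = 0"
    using common_zero[OF gap(2), of ?F] gap(1) by auto
  then show ?thesis by (auto simp: good_def subset_iff)
qed

lemma good_wsp: "good d v \<Longrightarrow> v \<in> wsp (\<nu>0 - 1)"
  by (simp add: good_def)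

lemma good_L0: "good d v \<Longrightarrow> X (bL 0) v = scale c v"
  by (simp add: good_def wsp_def c_def)

lemma good_1: "good d v \<Longrightarrow> 1 \<le> d \<Longrightarrow> deg b = 1 \<Longrightarrow> X b v = 0"
  unfolding good_def by (auto dest!: spec[of _ "[b]"])

lemma good_2: "good d v \<Longrightarrow> 2 \<le> d \<Longrightarrow> deg a + deg b = 1 \<Longrightarrow> \<bar>deg a\<bar> \<le> 6 \<Longrightarrow> \<bar>deg b\<bar> \<le> 6 \<Longrightarrow>
    X a (X b v) = 0"
  unfolding good_def by (auto dest!: spec[of _ "[a, b]"])

text \<open>The parameter of \<open>good\<close> is a budget of letters: applying a word of degree 0
  again gives a good vector, at the cost of the length of that word.\<close>

lemma good_append:
  assumes "good d v" "length ws + d' \<le> d" "\<forall>b\<in>set ws. \<bar>deg b\<bar> \<le> 6" "sum_list (map deg ws) = 0"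
  shows "good d' (foldr X ws v)"
  unfolding good_def
proof (intro conjI allI impI)
  show "foldr X ws v \<in> wsp (\<nu>0 - 1)"
    using word_wsp[of v "\<nu>0 - 1" _ ws] assms by (simp add: good_def)
  fix us
  assume us: "length us \<le> d'" "\<forall>b\<in>set us. \<bar>deg b\<bar> \<le> 6" "sum_list (map deg us) = 1"
  have "foldr X (us @ ws) v = 0"
    using assms us unfolding good_def by (elim conjE allE[of _ "us @ ws"]) auto
  then show "foldr X us (foldr X ws v) = 0" by simp
qed

lemma good_append1: "good d v \<Longrightarrow> Suc d' \<le> d \<Longrightarrow> deg a = 0 \<Longrightarrow> good d' (X a v)"
  using good_append[of d v "[a]" d'] by simp

lemma good_append2: "good d v \<Longrightarrow> d' + 2 \<le> d \<Longrightarrow> deg a + deg b = 0 \<Longrightarrow> \<bar>deg b\<bar> \<le> 6 \<Longrightarrow> good d' (X a (X b v))"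
  using good_append[of d v "[a, b]" d'] by simp

lemma good_subspace: "subspace {v. good d v}"
  using subspace_wsp[of "\<nu>0 - 1"] module_hom.add[OF module_hom_word] module_hom.scale[OF module_hom_word]
      module_hom.zero[OF module_hom_word]
  by (auto simp: subspace_def good_def)

lemma good_singular_up:
  assumes "good d v" "1 \<le> d" "\<And>b. deg b = 2 \<Longrightarrow> X b v = 0"
  shows "v = 0"
  using no_singular_up[OF good_wsp[OF assms(1)]] good_1[OF assms(1,2)] assms(3) by auto

text \<open>Letters of degree -1 kill \<open>X a v\<close> automatically, because they complete it
  to a word of degree 1. Only degree -2 has to be checked.\<close>

lemma good_singular_down:
  assumes "good d v" "2 \<le> d" "deg a = 2" "\<And>b. deg b = -2 \<Longrightarrow> X b (X a v) = 0"
  shows "X a v = 0"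
proof (rule no_singular_down)
  show "X a v \<in> wsp (\<nu>0 + 1)" using good_wsp[OF assms(1)] assms(3) by (intro X_wsp) auto
  show "X b (X a v) = 0" if "deg b = -1 \<or> deg b = -2" for b
    using that assms(4) good_2[OF assms(1,2), of b a] assms(3) by auto
qed

end

text \<open>A family \<open>B n\<close> of letters that spans an ideal of the algebra acting on the module and
  commutes up to sign with all letters other than the \<open>L m\<close>.\<close>

locale W22_ideal = W22_gap +
  fixes B :: "int \<Rightarrow> W22_basis" and \<alpha> :: complex
  assumes deg_B: "deg (B n) = n"
    and \<alpha>: "\<alpha> = 1 \<or> \<alpha> = 1 / 2"
    and LB: "X (bL m) (X (B n) x) =
      X (B n) (X (bL m) x) + scale (\<alpha> * of_int m - of_int n) (X (B (m + n)) x)"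
    and B_swap: "(\<And>m. b \<noteq> bL m) \<Longrightarrow>
      \<exists>e. e \<noteq> 0 \<and> (\<forall>n x. X (B n) (X b x) = scale e (X b (X (B n) x)))"
begin

text \<open>Exchanging \<open>B n\<close> and \<open>b\<close> creates at most a multiple of
  \<open>B (n + deg b)\<close>, and nothing at all unless \<open>b\<close> is some
  \<open>L m\<close>. The next lemma is the reverse direction.\<close>

lemma push: "X (B n) x = 0 \<Longrightarrow> X (B (n + deg b)) x = 0 \<Longrightarrow> X (B n) (X b x) = 0"
proof (cases "\<exists>m. b = bL m")
  case True
  then obtain m where "b = bL m" by auto
  then show "X (B n) x = 0 \<Longrightarrow> X (B (n + deg b)) x = 0 \<Longrightarrow> X (B n) (X b x) = 0"
    using LB[of m n x] by (simp add: add.commute)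
next
  case False
  with B_swap[of b] show "X (B n) x = 0 \<Longrightarrow> X (B n) (X b x) = 0" by auto
qed

lemma pull: "X (B n) (X b x) = 0 \<Longrightarrow> X (B (n + deg b)) x = 0 \<Longrightarrow> X b (X (B n) x) = 0"
proof (cases "\<exists>m. b = bL m")
  case True
  then obtain m where "b = bL m" by auto
  then show "X (B n) (X b x) = 0 \<Longrightarrow> X (B (n + deg b)) x = 0 \<Longrightarrow> X b (X (B n) x) = 0"
    using LB[of m n x] by (simp add: add.commute)
next
  case False
  with B_swap[of b] obtain e where "e \<noteq> 0" "\<And>n x. X (B n) (X b x) = scale e (X b (X (B n) x))"
    by blast
  then show "X (B n) (X b x) = 0 \<Longrightarrow> X b (X (B n) x) = 0" by simp
qed

text \<open>By \<open>push\<close>, the common kernel of all \<open>B n\<close> is a submodule, so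
  irreducibility applies.\<close>

lemma killed_imp_zero:
  assumes "v \<noteq> 0" "\<And>n. X (B n) v = 0"
  shows "X (B n) x = 0"
proof -
  let ?A = "{x. \<forall>n. X (B n) x = 0}"
  have "?A = {0} \<or> ?A = UNIV"
  proof (rule irr)
    show "subspace ?A" by (auto simp: subspace_def X_lin)
    show "X b x \<in> ?A" if "x \<in> ?A" for b x using that push by auto
    show "sg x \<in> ?A" if "x \<in> ?A" for x
    proof -
      have "X (B n) (sg x) = 0" for n
        using that sg_X[of "B n" x] by (auto split: if_splits)
      then show ?thesis by simp
    qed
  qed
  then show ?thesis using assms by blast
qed

text \<open>Bracketing with \<open>L_(-1)\<close> carries the vanishing of \<open>B_(-2)\<close> on
  the vectors \<open>X b v\<close> with \<open>deg b = 2\<close> to all lower indices. Then, by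
  induction on \<open>n\<close>, all letters of degree 1 and 2 pass through \<open>B_(-n)\<close>
  and kill \<open>B_(-n) v\<close>, which is zero because there are no singular vectors.\<close>

lemma tail_zero:
  assumes v: "v \<in> wsp (\<nu>0 - 1)" "\<And>b. deg b = 1 \<Longrightarrow> X b v = 0" "\<And>n. n \<ge> 0 \<Longrightarrow> X (B n) v = 0"
    and w: "\<And>b. deg b = 2 \<Longrightarrow> X (bL (-1)) (X b v) = 0"
      "\<And>b. deg b = 2 \<Longrightarrow> X (B (-1)) (X b v) = 0" "\<And>b. deg b = 2 \<Longrightarrow> X (B (-2)) (X b v) = 0"
  shows "X (B n) v = 0"
proof -
  have 1: "X (B (- n)) (X b v) = 0" if "n \<ge> 2" "deg b = 2" for n b
    using that(1)
  proof (induction n rule: int_ge_induct)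
    case (step n)
    have "of_int n - \<alpha> \<noteq> 0"
      using \<alpha> step.hyps one_minus_of_int_neq_0[of n] half_minus_of_int_neq_0[of n] by auto
    then have "X (B (- 1 - n)) (X b v) = 0"
      using LB[of "-1" "-n" "X b v"] w(1)[OF that(2)] step.IH by simp
    moreover have "- (n + 1) = - 1 - n" by simp
    ultimately show ?case by (simp only:)
  qed (use w that in simp)
  have 2: "X (B (- int n)) v = 0" for n
  proof (induction n rule: less_induct)
    case (less n)
    have n: "X (B (- int n + k)) v = 0" if "k > 0" for k
      using less[of "nat (int n - k)"] v(3)[of "- int n + k"] that by (cases "int n - k > 0") auto
    show ?case
    proof (cases "n = 0")
      case False
      show ?thesis
      proof (rule no_singular_up)
        show "X (B (- int n)) v \<in> wsp (\<nu>0 - 1 - of_int n)"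
          using v(1) by (intro X_wsp) (auto simp: deg_B)
        fix b assume b: "deg b = 1 \<or> deg b = 2"
        have "X (B (- int n)) (X b v) = 0"
          using b v(2) 1[of "int n" b] w(2)[of b] False by (cases "n = 1") auto
        then show "X b (X (B (- int n)) v) = 0" using n b by (intro pull) auto
      qed
    qed (use v(3)[of 0] in simp)
  qed
  show ?thesis using v(3) 2[of "nat (- n)"] by (cases "n \<ge> 0") auto
qed

text \<open>Bracketing with \<open>L_1\<close> raises the index with factor
  \<open>\<alpha> - n\<close>. For \<open>\<alpha> = 1\<close> it vanishes at \<open>n = 1\<close>,
  so index 2 is an assumption.\<close>

lemma good_B_pos:
  assumes "good d v" "1 \<le> d" "X (B 2) v = 0" "n \<ge> 1"
  shows "X (B n) v = 0"
proof -
  note L1 = good_1[OF assms(1,2), of "bL 1"]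
  have "X (B n) v = 0" if "n \<ge> 2" for n
    using that
  proof (induction n rule: int_ge_induct)
    case (step n)
    have "\<alpha> - of_int n \<noteq> 0"
      using \<alpha> step.hyps one_minus_of_int_neq_0[of n] half_minus_of_int_neq_0[of n] by auto
    then show ?case using LB[of 1 n v] L1 step.IH by (simp add: add.commute[of 1 n])
  qed (use assms in simp)
  then show ?thesis using assms(4) good_1[OF assms(1,2), of "B 1"] deg_B by (cases "n = 1") auto
qed

end

section \<open>Odd ideals act as zero\<close>

locale W22_odd_ideal = W22_ideal +
  assumes half: "\<alpha> = 1 / 2"
    and anti: "X (B m) (X (B n) x) = - X (B n) (X (B m) x)"
begin

lemma B_B: "X (B n) (X (B n) x) = 0"
  using anti[of n n x] by (metis add_eq_0_iff2 scale_eq_0_iff scale_left_distrib scale_one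
      one_add_one zero_neq_numeral)

text \<open>Good vectors are killed by \<open>B n\<close> for positive \<open>n\<close>. Of the
  hypotheses of \<open>tail_zero\<close>, only \<open>B_0 v = 0\<close> and
  \<open>B_(-2) X_b v = 0\<close> for \<open>deg b = 2\<close> are then not degree 1 relations. As
  each \<open>B n\<close> squares to zero, both are reached by replacing the vector, if necessary,
  by its image under the operator that should vanish.\<close>

lemma ex_killed: "\<exists>v. v \<noteq> 0 \<and> (\<forall>n. X (B n) v = 0)"
proof -
  have B2: "X (B 2) v = 0" if "good d v" "1 \<le> d" for d v
    using LB[of 1 1 v] good_1[OF that, of "bL 1"] good_1[OF that, of "B 1"] half by (simp add: deg_B)
  obtain v1 where v1: "v1 \<noteq> 0" "good 5 v1" using ex_good by blast
  obtain v2 where v2: "v2 \<noteq> 0" "good 4 v2" "X (B 0) v2 = 0"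
  proof (cases "X (B 0) v1 = 0")
    case True
    have "good 4 v1" using good_append[OF v1(2), of "[]" 4] by simp
    then show ?thesis using that v1 True by blast
  next
    case False
    then show ?thesis
      using that B_B good_append1[OF v1(2), of 4 "B 0"] deg_B by simp
  qed
  have pos: "X (B n) v2 = 0" if "n \<ge> 0" for n
    using good_B_pos[OF v2(2) _ B2[OF v2(2)], of n] v2(3) that by (cases "n = 0") auto
  have y: "X (B n) (X b v2) = 0" if "n \<ge> 0" "deg b = 2" for n b
    using that pos by (intro push) auto
  obtain v3 where v3: "v3 \<noteq> 0" "good 2 v3" "X (B 0) v3 = 0"
    "\<And>b. deg b = 2 \<Longrightarrow> X (B (-2)) (X b v3) = 0"
  proof (cases "\<exists>b. deg b = 2 \<and> X (B (-2)) (X b v2) \<noteq> 0")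
    case True
    then obtain b where b: "deg b = 2" "X (B (-2)) (X b v2) \<noteq> 0" by auto
    let ?r = "X (B (-2)) (X b v2)"
    \<comment> \<open>\<open>B_0\<close> anticommutes with \<open>B_(-2)\<close> and kills
      \<open>X b v2\<close>. The vanishing of both operators on \<open>?r\<close> is what
      \<open>push\<close> needs to move \<open>B_(-2)\<close> past a letter of degree 2.\<close>
    have r: "X (B 0) ?r = 0" "X (B (-2)) ?r = 0"
      using anti[of 0 "-2" "X b v2"] y b(1) by (simp_all add: B_B)
    have "X (B (-2)) (X b' ?r) = 0" if "deg b' = 2" for b'
      using push[of "-2" ?r b'] r that by simp
    then show ?thesis
      using that b r good_append2[OF v2(2), of 2 "B (-2)" b] deg_B by simp
  next
    case False
    have "good 2 v2" using good_append[OF v2(2), of "[]" 2] by simp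
    then show ?thesis using that v2 False by blast
  qed
  have "X (B n) v3 = 0" for n
  proof (rule tail_zero)
    show "X (B n) v3 = 0" if "n \<ge> 0" for n
      using good_B_pos[OF v3(2) _ B2[OF v3(2)], of n] v3(3) that by (cases "n = 0") auto
  qed (use v3 good_wsp[OF v3(2)] good_1[OF v3(2)] good_2[OF v3(2)] deg_B in auto)
  then show ?thesis using v3(1) by blast
qed

lemma B_zero: "X (B n) x = 0"
  using ex_killed killed_imp_zero by blast

end

section \<open>Consequences of the degree 1 relations for \<open>L\<close> and
  \<open>I\<close>\<close>

context W22_gap
begin

lemma good_G:
  assumes "good d v" "1 \<le> d" "n \<ge> 1"
  shows "X (bG n) v = 0"
  using assms(3)
proof (induction n rule: int_ge_induct)
  case (step n)
  then show ?case
    using raise_G[of v n] good_1[OF assms(1,2)] by (simp add: add.commute)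
qed (use good_1[OF assms(1,2)] in simp)

lemma good_L_raise:
  assumes "good d v" "1 \<le> d"
  shows "X (bL 1) (X (bL n) v) = scale (1 - of_int n) (X (bL (n + 1)) v)"
    and "X (bL 1) (X (bI n) v) = scale (1 - of_int n) (X (bI (n + 1)) v)"
  using LL[of 1 n v] LI[of 1 n v] good_1[OF assms, of "bL 1"] by (simp_all add: add.commute)

text \<open>Apply \<open>L_1\<close> to the degree 1 relations \<open>L_2 L_(-1) v = 0\<close> and
  \<open>I_2 L_(-1) v = 0\<close>, using \<open>L_1 L_(-1) v = 2 c v\<close>, and then exchange the
  two letters.\<close>

lemma good_lower_3:
  assumes "good d v" "3 \<le> d"
  shows "X (bL (-1)) (X (bL 3) v) = scale (2 * c - 4) (X (bL 2) v)"
    and "X (bL (-1)) (X (bI 3) v) = scale (2 * c - 4) (X (bI 2) v)"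
    and "X (bL 3) (X (bL (-1)) v) = scale (2 * c) (X (bL 2) v)"
proof -
  have z: "X (bL 1) v = 0" "X (bL 2) (X (bL (-1)) v) = 0" "X (bI 2) (X (bL (-1)) v) = 0"
    using good_1[OF assms(1)] good_2[OF assms(1)] assms(2) by auto
  have u: "X (bL 1) (X (bL (-1)) v) = scale (2 * c) v"
    using LL[of 1 "-1" v] z good_L0[OF assms(1)] by simp
  show 3: "X (bL 3) (X (bL (-1)) v) = scale (2 * c) (X (bL 2) v)"
    using LL[of 1 2 "X (bL (-1)) v"] z u by (simp add: X_lin)
  have 4: "X (bI 3) (X (bL (-1)) v) = scale (2 * c) (X (bI 2) v)"
    using LI[of 1 2 "X (bL (-1)) v"] z u by (simp add: X_lin)
  show "X (bL (-1)) (X (bL 3) v) = scale (2 * c - 4) (X (bL 2) v)"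
    using LL[of "-1" 3 v] 3 by (simp add: scale_left_diff_distrib)
  show "X (bL (-1)) (X (bI 3) v) = scale (2 * c - 4) (X (bI 2) v)"
    using LI[of "-1" 3 v] 4 by (simp add: scale_left_diff_distrib)
qed

text \<open>The factor \<open>2 c - 4\<close> of the preceding lemma must be invertible. The
  excluded value \<open>c = 2\<close> is handled at the end by the flip.\<close>

lemma good_3_imp_2:
  assumes "good d v" "3 \<le> d" "c \<noteq> 2"
  shows "X (bL 3) v = 0 \<Longrightarrow> X (bL 2) v = 0" "X (bI 3) v = 0 \<Longrightarrow> X (bI 2) v = 0"
proof -
  have "2 * c - 4 \<noteq> 0"
  proof
    assume "2 * c - 4 = 0"
    then have "c = 2" by algebra
    then show False using assms(3) by simp
  qed
  then show "X (bL 3) v = 0 \<Longrightarrow> X (bL 2) v = 0" "X (bI 3) v = 0 \<Longrightarrow> X (bI 2) v = 0"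
    using good_lower_3(1,2)[OF assms(1,2)] by (simp_all only: X_zero) (metis scale_eq_0_iff)+
qed

end

section \<open>The letters \<open>I\<close> act as zero\<close>

locale W22_no_H = W22_gap +
  assumes H_zero: "X (bH n) x = 0"
begin

sublocale I: W22_ideal scale X sg \<nu>0 bI 1
proof unfold_locales
  show "X (bL m) (X (bI n) x) = X (bI n) (X (bL m) x) +
      scale (1 * of_int m - of_int n) (X (bI (m + n)) x)" for m n x
    using LI[of m n x] by simp
  fix b assume b: "\<And>m. b \<noteq> bL m"
  have "X (bI n) (X b x) = scale 1 (X b (X (bI n) x))" for n x
    using b by (cases b) (use II IG IH in \<open>auto simp: H_zero\<close>)
  then show "\<exists>e. e \<noteq> 0 \<and> (\<forall>n x. X (bI n) (X b x) = scale e (X b (X (bI n) x)))"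
    by (intro exI[of _ 1]) simp
qed simp_all

text \<open>Applying \<open>L_1\<close> twice to the degree 1 relations
  \<open>I_(-1) I_2 v = 0\<close> and \<open>I_(-2) I_3 v = 0\<close> gives two linear relations in
  degree 3 between \<open>I_0 I_3 v\<close>, \<open>I_(-1) I_4 v\<close> and
  \<open>I_(-2) I_5 v\<close>. The last of these is zero by \<open>Y\<close>, and the resulting 2 by
  2 system is nonsingular.\<close>

lemma I0_I3_zero:
  assumes "good d v" "2 \<le> d" and Y: "X (bI (-2)) (X (bI 2) v) = 0"
  shows "X (bI 0) (X (bI 3) v) = 0"
proof -
  have one: "X (bL 1) v = 0" "X (bI 1) v = 0"
    using good_1[OF assms(1)] assms(2) by auto
  have word: "X (bI (-1)) (X (bI 2) v) = 0" "X (bI (-2)) (X (bI 3) v) = 0"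
    "X (bI (-2)) (X (bL 3) v) = 0"
    using good_2[OF assms(1,2)] by auto
  note L1 = good_L_raise(2)[OF assms(1), of 2] good_L_raise(2)[OF assms(1), of 3]
    good_L_raise(2)[OF assms(1), of 4]
  have A: "X (bI (-1)) (X (bI 3) v) = scale 2 (X (bI 0) (X (bI 2) v))"
    using LI[of 1 "-1" "X (bI 2) v"] word L1 assms(2) by (simp add: X_lin)
  have B: "scale 2 (X (bI (-2)) (X (bI 4) v)) = scale 3 (X (bI (-1)) (X (bI 3) v))"
    using LI[of 1 "-2" "X (bI 3) v"] word L1 assms(2) by (simp add: X_lin)
  have I12: "X (bI 1) (X (bI 2) v) = 0" using II[of 1 2 v] one by simp
  have C: "X (bL 1) (X (bI (-1)) (X (bI 3) v)) =
      scale 2 (X (bI 0) (X (bI 3) v)) - scale 2 (X (bI (-1)) (X (bI 4) v))"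
    using LI[of 1 "-1" "X (bI 3) v"] L1 assms(2) by (simp add: X_lin)
  have C': "X (bL 1) (X (bI 0) (X (bI 2) v)) = - X (bI 0) (X (bI 3) v)"
    using LI[of 1 0 "X (bI 2) v"] L1 I12 assms(2) by (simp add: X_lin)
  have D: "X (bL 1) (X (bI (-2)) (X (bI 4) v)) =
      scale 3 (X (bI (-1)) (X (bI 4) v)) - scale 3 (X (bI (-2)) (X (bI 5) v))"
    using LI[of 1 "-2" "X (bI 4) v"] L1 assms(2) by (simp add: X_lin)
  \<comment> \<open>Next \<open>L_3\<close> is applied to \<open>Y\<close>: \<open>I_5\<close>
    arises from \<open>[L_3, I_2]\<close>, and all other terms vanish.\<close>
  have "X (bI (-2)) (X (bI 2) (X (bL 3) v)) = 0"
    using II[of "-2" 2 "X (bL 3) v"] word by simp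
  then have E: "X (bI (-2)) (X (bI 5) v) = 0"
    using LI[of 3 "-2" "X (bI 2) v"] LI[of 3 2 v] I12 Y by (simp add: X_lin)
  show ?thesis
  proof (rule vec_eqI)
    fix \<phi> assume "module_hom scale (*) \<phi>"
    then interpret \<phi>: module_hom scale "(*)" \<phi> .
    have "2 * \<phi> (X (bI 0) (X (bI 3) v)) - 2 * \<phi> (X (bI (-1)) (X (bI 4) v)) = - 2 * \<phi> (X (bI 0) (X (bI 3) v))"
      using arg_cong[OF arg_cong[OF A, of "X (bL 1)"], of \<phi>]
      by (simp add: C C' X_lin \<phi>.add \<phi>.scale \<phi>.diff \<phi>.neg \<phi>.zero)
    moreover have "6 * \<phi> (X (bI (-1)) (X (bI 4) v)) =
        3 * (2 * \<phi> (X (bI 0) (X (bI 3) v)) - 2 * \<phi> (X (bI (-1)) (X (bI 4) v)))"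
      using arg_cong[OF arg_cong[OF B, of "X (bL 1)"], of \<phi>]
      by (simp add: C D E X_lin \<phi>.add \<phi>.scale \<phi>.diff \<phi>.neg \<phi>.zero)
    ultimately show "\<phi> (X (bI 0) (X (bI 3) v)) = \<phi> 0"
      unfolding \<phi>.zero by algebra
  qed
qed

text \<open>If a letter of degree -2 does not annihilate \<open>I\<^sub>2 v\<close>, it maps it to a vector killed by
  \<open>I\<^sub>3\<close>; otherwise \<open>I\<^sub>2 v\<close> is singular, hence zero.\<close>

lemma ex_I3_zero: "\<exists>v. v \<noteq> 0 \<and> good 5 v \<and> X (bI 3) v = 0"
proof -
  obtain v where v: "v \<noteq> 0" "good 7 v" using ex_good by blast
  have word: "X (bI 3) (X (bI (-2)) v) = 0" "X (bI 3) (X (bL (-2)) v) = 0"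
    using good_2[OF v(2)] by auto
  show ?thesis
  proof (cases "X (bI (-2)) (X (bI 2) v) = 0")
    case False
    moreover have "X (bI 3) (X (bI (-2)) (X (bI 2) v)) = 0"
      using II[of 3 2 "X (bI (-2)) v"] II[of "-2" 2 v] word by simp
    ultimately show ?thesis using good_append2[OF v(2), of 5 "bI (-2)" "bI 2"] by auto
  next
    case True
    have I03: "X (bI 3) (X (bI 0) v) = 0" using I0_I3_zero[OF v(2) _ True] II[of 3 0 v] by simp
    have p: "X (bL (-2)) (X (bI 2) v) = X (bI 2) (X (bL (-2)) v) - scale 4 (X (bI 0) v)"
      using LI[of "-2" 2 v] by simp
    show ?thesis
    proof (cases "X (bL (-2)) (X (bI 2) v) = 0")
      case False
      moreover have "X (bI 3) (X (bL (-2)) (X (bI 2) v)) = 0"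
        unfolding p using II[of 3 2 "X (bL (-2)) v"] word I03 by (simp add: X_lin)
      ultimately show ?thesis using good_append2[OF v(2), of 5 "bL (-2)" "bI 2"] by auto
    next
      case L: True
      have "X (bI 2) v = 0"
      proof (rule good_singular_down[OF v(2)])
        fix b assume b: "deg b = -2"
        \<comment> \<open>\<open>G_(-2)\<close> is twice the bracket of \<open>L_(-1)\<close> and
          \<open>G_(-1)\<close>, and both of these kill \<open>I_2 v\<close> by degree 1
          relations.\<close>
        have "X (bG (-2)) (X (bI 2) v) = 0"
          using LG[of "-1" "-1" "X (bI 2) v"] good_2[OF v(2), of "bG (-1)" "bI 2"]
            good_2[OF v(2), of "bL (-1)" "bI 2"] by simp
        then show "X b (X (bI 2) v) = 0"
          using b L True H_zero by (cases b) auto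
      qed simp_all
      then have "X (bI 3) v = 0" using good_L_raise(2)[OF v(2), of 2] by simp
      moreover have "good 5 v" using good_append[OF v(2), of "[]" 5] by simp
      ultimately show ?thesis using v(1) by blast
    qed
  qed
qed

text \<open>From \<open>I_3 v = 0\<close> one gets \<open>I_n v = 0\<close> for
  \<open>n >= 1\<close>, then for \<open>n = 0\<close> and \<open>n = -1\<close> by the absence of
  singular vectors. What \<open>tail_zero\<close> still requires is that
  \<open>?r = I_(-2) L_2 v\<close> vanishes: it is good and killed by \<open>L_3\<close>, hence by
  \<open>L_2\<close>, hence by all letters of degree 2.\<close>

lemma I_zero:
  assumes "c \<noteq> 2"
  shows "X (bI n) x = 0"
proof -
  obtain v where v: "v \<noteq> 0" "good 5 v" "X (bI 3) v = 0" using ex_I3_zero by blast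
  have I2: "X (bI 2) v = 0" using good_3_imp_2(2)[OF v(2) _ assms v(3)] by simp
  have pos: "X (bI n) v = 0" if "n \<ge> 1" for n
    using I.good_B_pos[OF v(2) _ I2 that] by simp
  have two: "X b v = 0" if "deg b = 2" "b \<noteq> bL 2" for b
    using that I2 good_G[OF v(2), of 2] H_zero by (cases b) auto
  have one: "X b v = 0" if "deg b = 1" for b using good_1[OF v(2) _ that] by simp
  have word: "X a (X b v) = 0" if "deg a + deg b = 1" "\<bar>deg a\<bar> \<le> 6" "\<bar>deg b\<bar> \<le> 6" for a b
    using good_2[OF v(2) _ that] by simp
  have I1: "X (bI 1) (X (bL 2) v) = 0" using pos by (intro I.push) auto
  then have "X (bI 0) (X (bL 2) v) = 0"
    using LI[of "-1" 1 "X (bL 2) v"] word[of "bL (-1)" "bL 2"] by simp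
  then have I0L: "X (bI 0) (X b v) = 0" if "deg b = 2" for b using two[OF that] by (cases "b = bL 2") auto
  have I0: "X (bI 0) v = 0"
  proof (rule good_singular_up)
    show "good 4 (X (bI 0) v)" using good_append1[OF v(2), of 4 "bI 0"] by simp
    show "X b (X (bI 0) v) = 0" if "deg b = 2" for b
      using I0L[OF that] pos[of 2] that by (intro I.pull) auto
  qed auto
  have Im1: "X (bI (-1)) v = 0"
  proof (rule no_singular_up)
    show "X (bI (-1)) v \<in> wsp (\<nu>0 - 2)" using good_wsp[OF v(2)] by (intro X_wsp) auto
    show "X b (X (bI (-1)) v) = 0" if "deg b = 1 \<or> deg b = 2" for b
      using that
    proof
      assume "deg b = 1"
      then show ?thesis using one I0 by (intro I.pull) auto
    next
      assume "deg b = 2"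
      then show ?thesis using word[of "bI (-1)" b] pos[of 1] by (intro I.pull) auto
    qed
  qed
  let ?r = "X (bI (-2)) (X (bL 2) v)"
  have nonneg: "X (bI n) v = 0" if "n \<ge> -1" for n
    using pos[of n] I0 Im1 that by (cases "n = -1"; cases "n = 0") auto
  have r: "good 3 ?r" using good_append2[OF v(2), of 3 "bI (-2)" "bL 2"] by simp
  have I_L: "X (bI n) (X (bL k) v) = 0" if "n \<ge> -1" "k \<ge> 0" for n k
    using nonneg that by (intro I.push) auto
  \<comment> \<open>Raising with \<open>L_1\<close> turns \<open>I_(-2) L_3 v = 0\<close> into the
    same relation for \<open>L_4\<close> and \<open>L_5\<close>; the latter occurs in
    \<open>L_3 ?r\<close> through \<open>[L_3, L_2] = L_5\<close>.\<close>
  note L1 = good_L_raise(1)[OF v(2), of 3] good_L_raise(1)[OF v(2), of 4]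
  have w3: "X (bI (-2)) (X (bL 3) v) = 0" using word by simp
  have w4: "X (bI (-2)) (X (bL 4) v) = 0"
    using LI[of 1 "-2" "X (bL 3) v"] w3 L1 I_L[of "-1" 3] by (simp add: X_lin)
  have w5: "X (bI (-2)) (X (bL 5) v) = 0"
    using LI[of 1 "-2" "X (bL 4) v"] w4 L1 I_L[of "-1" 4] by (simp add: X_lin)
  have "X (bI (-2)) (X (bL 2) (X (bL 3) v)) = 0"
    using I.push[of "-2" "X (bL 3) v" "bL 2"] w3 I_L[of 0 3] by simp
  then have "X (bL 3) ?r = 0"
    using LI[of 3 "-2" "X (bL 2) v"] LL[of 3 2 v] w5 I_L[of 1 2] by (simp add: X_lin)
  then have L2: "X (bL 2) ?r = 0" using good_3_imp_2(1)[OF r _ assms] by simp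
  have "?r = 0"
  proof (rule good_singular_up[OF r])
    fix b assume "deg b = 2"
    have "X (bI 2) (X (bI (-2)) (X (bL 2) v)) = 0"
      using II[of 2 "-2" "X (bL 2) v"] I_L[of 2 2] by simp
    then show "X b ?r = 0"
      using \<open>deg b = 2\<close> L2 good_G[OF r, of 2] H_zero by (cases b) auto
  qed simp
  then have I2b: "X (bI (-2)) (X b v) = 0" if "deg b = 2" for b
    using two[OF that] by (cases "b = bL 2") auto
  have "X (bI n) v = 0" for n
  proof (rule I.tail_zero[OF good_wsp[OF v(2)] one])
    show "X (bI n) v = 0" if "n \<ge> 0" for n using nonneg[of n] that by simp
    show "X (bL (-1)) (X b v) = 0" "X (bI (-1)) (X b v) = 0" if "deg b = 2" for b
      using word[of _ b] that by simp_all
  qed (use I2b in auto)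
  then show ?thesis using v(1) I.killed_imp_zero by blast
qed

end

section \<open>The Witt algebra\<close>

locale W22_Witt = W22_inf +
  assumes not_L_zero: "(\<And>m. b \<noteq> bL m) \<Longrightarrow> X b x = 0"
begin

abbreviation L :: "int \<Rightarrow> 'a \<Rightarrow> 'a" where "L n \<equiv> X (bL n)"

lemma singular_up:
  assumes "z \<in> wsp \<nu>" "L 1 z = 0" "L 2 z = 0"
  shows "z = 0"
  using assms(1)
proof (rule no_singular_up)
  show "X b z = 0" if "deg b = 1 \<or> deg b = 2" for b
    using that assms(2,3) not_L_zero[of b z] by (cases b) auto
qed

lemma singular_down:
  assumes "z \<in> wsp \<nu>" "L (-1) z = 0" "L (-2) z = 0"
  shows "z = 0"
  using assms(1)
proof (rule no_singular_down)
  show "X b z = 0" if "deg b = -1 \<or> deg b = -2" for b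
    using that assms(2,3) not_L_zero[of b z] by (cases b) auto
qed

text \<open>\<open>T m n\<close> vanishes when \<open>v\<close> is the vector \<open>t\<^sup>-\<^sup>1\<close> of the module of Laurent polynomials modulo
  constants, with \<open>L\<^sub>n\<close> acting as \<open>-t\<^bsup>n+1\<^esup> d/dt\<close>.\<close>

definition T :: "'a \<Rightarrow> int \<Rightarrow> int \<Rightarrow> 'a" where
  "T v m n = L m (L n v) - scale (1 - of_int n) (L (m + n) v)"

text \<open>The last three relations say that \<open>T\<close> vanishes at \<open>(-1, 2)\<close>,
  \<open>(-2, 2)\<close> and \<open>(-1, -1)\<close>. All other values of \<open>T\<close> are shown
  to vanish from these.\<close>

context
  fixes v
  assumes v: "v \<in> wsp (-1)" "L 1 v = 0" "L (-1) (L 2 v) = 0" "L (-2) (L 2 v) = - v"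
    "L (-1) (L (-1) v) = scale 2 (L (-2) v)"
begin

lemma L0_v: "L 0 v = v"
  using v(1) by (simp add: wsp_def)

text \<open>The coefficients \<open>1 - n\<close> and \<open>1 - m\<close> differ by the structure
  constant \<open>m - n\<close> of \<open>[L_m, L_n]\<close>.\<close>

lemma T_sym: "T v m n = T v n m"
proof -
  have "scale (1 - of_int n) (L (m + n) v) =
      scale (1 - of_int m) (L (m + n) v) + scale (of_int m - of_int n) (L (m + n) v)"
    by (simp flip: scale_left_distrib)
  then show ?thesis
    using LL[of m n v] by (simp add: T_def add.commute[of n m])
qed

lemma T_0_1 [simp]: "T v m 0 = 0" "T v m 1 = 0" "T v 0 m = 0" "T v 1 m = 0"
proof -
  show "T v m 0 = 0" "T v m 1 = 0" for m by (simp_all add: T_def L0_v v(2))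
  then show "T v 0 m = 0" "T v 1 m = 0" by (simp_all add: T_sym[of _ m])
qed

lemma T_wsp: "T v m n \<in> wsp (of_int (m + n) - 1)"
  unfolding T_def using v(1)
  by (intro subspace_diff subspace_scale subspace_wsp X_wsp[of _ "of_int n - 1"] X_wsp[of v "-1"]) auto

text \<open>\<open>T v m n\<close> is the defect from the rule
  \<open>L_m L_n v = (1 - n) L_(m+n) v\<close>. This rule respects the Witt relations, so moving
  \<open>L k\<close> inwards produces only defects.\<close>

lemma L_T: "L k (T v m n) = scale (of_int (k - m)) (T v (k + m) n) + scale (1 - of_int n) (T v m (k + n))
    + L m (T v k n) - scale (1 - of_int n) (T v k (m + n))"
proof (rule vec_eqI)
  fix \<phi> assume "module_hom scale (*) \<phi>"
  then interpret \<phi>: module_hom scale "(*)" \<phi> .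
  have LLL: "\<phi> (L k (L m (L n v))) = \<phi> (L m (L k (L n v))) + (of_int k - of_int m) * \<phi> (L (k + m) (L n v))"
    using arg_cong[OF LL[of k m "L n v"], of \<phi>] by (simp only: \<phi>.add \<phi>.scale)
  have idx: "k + m + n = k + (m + n)" "m + (k + n) = k + (m + n)" by simp_all
  show "\<phi> (L k (T v m n)) = \<phi> (scale (of_int (k - m)) (T v (k + m) n) +
      scale (1 - of_int n) (T v m (k + n)) + L m (T v k n) - scale (1 - of_int n) (T v k (m + n)))"
    unfolding T_def X_diff X_scale \<phi>.add \<phi>.scale \<phi>.diff of_int_add of_int_diff LLL idx by algebra
qed

lemma L1_T: "L 1 (T v m n) = scale (1 - of_int m) (T v (1 + m) n) + scale (1 - of_int n) (T v m (1 + n))"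
  using L_T[of 1 m n] by simp

lemma T_zero_up: "T v m n = 0 \<Longrightarrow> T v (m + 1) n = 0 \<Longrightarrow> n \<noteq> 1 \<Longrightarrow> T v m (n + 1) = 0"
  using L1_T[of m n] one_minus_of_int_neq_0[of n] by (simp add: add.commute)

lemma T_minus1_pos: "T v (-1) n = 0" if "n \<ge> 0"
proof -
  have "T v (-1) n = 0" if "n \<ge> 2" for n
    using that
  proof (induction n rule: int_ge_induct)
    case base
    show ?case by (simp add: T_def v)
  next
    case (step n)
    then show ?case using T_zero_up[of "-1" n] by simp
  qed
  then show ?thesis using that by (cases "n = 0"; cases "n = 1") auto
qed

lemma T_minus2_2: "T v (-2) 2 = 0"
  by (simp add: T_def v L0_v)

lemma T_minus2_pos: "T v (-2) n = 0" if "n \<ge> 0"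
proof -
  have "T v (-2) n = 0" if "n \<ge> 2" for n
    using that
  proof (induction n rule: int_ge_induct)
    case base
    show ?case by (rule T_minus2_2)
  next
    case (step n)
    then show ?case using T_zero_up[of "-2" n] T_minus1_pos[of n] by simp
  qed
  then show ?thesis using that by (cases "n = 0"; cases "n = 1") auto
qed

text \<open>The rows -1 and 2 are treated together, with row 2 one index ahead.
  \<open>L_(-1)\<close> applied to \<open>T v k 2 = 0\<close> gives the new entry of row 2, and this
  entry occurs in \<open>L_2 (T v (-1) k)\<close>. So \<open>T v (-1) k\<close> is killed by
  \<open>L_1\<close> and \<open>L_2\<close>.\<close>

lemma T_neg:
  "(\<forall>j \<ge> - 1 - int n. T v (-1) j = 0) \<and> (\<forall>j. - 2 - int n \<le> j \<and> j \<le> 0 \<longrightarrow> T v 2 j = 0)"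
proof (induction n)
  case 0
  have "T v (-1) j = 0" if "j \<ge> -1" for j
    using that T_minus1_pos[of j] by (cases "j = -1") (simp_all add: T_def v)
  moreover have "T v 2 j = 0" if "-2 \<le> j" "j \<le> 0" for j
  proof -
    from that consider "j = 0" | "j = -1" | "j = -2" by linarith
    then show ?thesis
      using T_minus2_2 T_minus1_pos[of 2] by cases (simp_all add: T_sym[of 2])
  qed
  ultimately show ?case by simp
next
  case (Suc n)
  define k where "k = - 2 - int n"
  have IH: "T v (-1) j = 0" if "j \<ge> k + 1" for j using Suc that by (auto simp: k_def)
  have IH2: "T v 2 j = 0" if "k \<le> j" "j \<le> 0" for j using Suc that by (auto simp: k_def)
  have "k \<le> -2" by (simp add: k_def)
  have T2: "T v 2 (k - 1) = 0"
  proof -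
    have "T v k 2 = 0" using IH2[of k] T_sym[of k 2] \<open>k \<le> -2\<close> by simp
    then have "scale (of_int (- 1 - k)) (T v (- 1 + k) 2) = 0"
      using L_T[of "-1" k 2] T_minus1_pos[of 2] IH[of "k + 2"] by simp
    moreover have "(of_int (- 1 - k) :: complex) \<noteq> 0" using \<open>k \<le> -2\<close> unfolding of_int_eq_0_iff by simp
    ultimately have "T v (- 1 + k) 2 = 0" unfolding scale_eq_0_iff by blast
    then show ?thesis using T_sym[of 2 "k - 1"] by (simp add: algebra_simps)
  qed
  have T1: "T v (-1) k = 0"
  proof (rule singular_up[OF T_wsp])
    show "L 1 (T v (-1) k) = 0"
      using L1_T[of "-1" k] IH[of "1 + k"] by simp
    show "L 2 (T v (-1) k) = 0"
      using L_T[of 2 "-1" k] IH[of "2 + k"] IH2[of k] T2 \<open>k \<le> -2\<close> by simp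
  qed
  have "T v (-1) j = 0" if "j \<ge> k" for j using that IH[of j] T1 by (cases "j = k") auto
  moreover have "T v 2 j = 0" if "k - 1 \<le> j" "j \<le> 0" for j
    using that IH2[of j] T2 by (cases "j = k - 1") auto
  ultimately show ?case by (auto simp: k_def)
qed

lemma T_minus1: "T v (-1) j = 0"
  using T_neg[of "nat (- 1 - j)"] T_minus1_pos[of j] by (cases "j \<ge> 0") auto

lemma T_2_neg: "j \<le> 0 \<Longrightarrow> T v 2 j = 0"
  using T_neg[of "nat (- j)"] by auto

lemma T_minus2: "T v (-2) j = 0"
proof -
  have "\<forall>j \<ge> - int n. T v (-2) j = 0" for n
  proof (induction n)
    case 0
    show ?case using T_minus2_pos by simp
  next
    case (Suc n)
    define k where "k = - 1 - int n"
    have IH: "T v (-2) j = 0" if "j \<ge> k + 1" for j using Suc that by (auto simp: k_def)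
    have "T v (-2) k = 0"
    proof (rule singular_up[OF T_wsp])
      show "L 1 (T v (-2) k) = 0"
        using L1_T[of "-2" k] T_minus1[of k] IH[of "1 + k"] by simp
      show "L 2 (T v (-2) k) = 0"
        using L_T[of 2 "-2" k] IH[of "2 + k"] T_2_neg[of k] T_2_neg[of "-2 + k"] by (simp add: k_def)
    qed
    then have "T v (-2) j = 0" if "j \<ge> k" for j using that IH[of j] by (cases "j = k") auto
    then show ?case by (simp add: k_def)
  qed
  from this[of "nat (- j)"] show ?thesis by auto
qed

text \<open>For positive second index, vectors killed by \<open>L_(-1)\<close> and
  \<open>L_(-2)\<close> are used; the rows -1 and -2 that enter are already zero.\<close>

lemma T_2: "T v 2 j = 0"
proof -
  have "\<forall>j \<le> int n. T v 2 j = 0" for n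
  proof (induction n)
    case 0
    show ?case using T_2_neg by simp
  next
    case (Suc n)
    define k where "k = 1 + int n"
    have IH: "T v 2 j = 0" if "j < k" for j using Suc that by (auto simp: k_def)
    have "T v 2 k = 0"
    proof (rule singular_down[OF T_wsp])
      show "L (-1) (T v 2 k) = 0"
        using L_T[of "-1" 2 k] T_minus1[of k] T_minus1[of "2 + k"] IH[of "-1 + k"] by simp
      show "L (-2) (T v 2 k) = 0"
        using L_T[of "-2" 2 k] T_minus2[of k] T_minus2[of "2 + k"] IH[of "-2 + k"] by simp
    qed
    then have "T v 2 j = 0" if "j \<le> k" for j using that IH[of j] by (cases "j = k") auto
    then show ?case by (simp add: k_def)
  qed
  from this[of "nat j"] show ?thesis by auto
qed

text \<open>The rows that vanish behave like a subalgebra, so the rows 1, 2 and -1, -2 yield all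
  positive and all negative ones.\<close>

lemma T_sum:
  assumes "\<And>j. T v k j = 0" "\<And>j. T v m j = 0" "k \<noteq> m"
  shows "T v (k + m) n = 0"
proof -
  have "scale (of_int (k - m)) (T v (k + m) n) = 0"
    using L_T[of k m n] assms(1,2) by simp
  moreover have "(of_int (k - m) :: complex) \<noteq> 0" using assms(3) unfolding of_int_eq_0_iff by simp
  ultimately show ?thesis unfolding scale_eq_0_iff by blast
qed

lemma T_zero: "T v m n = 0"
proof -
  have pos: "\<forall>n. T v m n = 0" if "m \<ge> 2" for m
    using that
  proof (induction m rule: int_ge_induct)
    case (step m)
    then show ?case using T_sum[of m 1] by simp
  qed (simp add: T_2)
  have neg: "\<forall>n. T v m n = 0" if "m \<le> -2" for m
    using that
  proof (induction m rule: int_le_induct)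
    case (step m)
    then show ?case using T_sum[of m "-1"] T_minus1 by simp
  qed (simp add: T_minus2)
  consider "m \<ge> 2" | "m \<le> -2" | "m = 0" | "m = 1" | "m = -1" by linarith
  then show ?thesis using pos neg T_minus1 by cases auto
qed

lemma finite_dim_wsp:
  assumes "v \<noteq> 0" "sg v = scale e v"
  shows "finite_dim (wsp (-1))"
proof -
  let ?N = "span (\<Union>n. {L n v})"
  have "?N = {0} \<or> ?N = UNIV"
  proof (rule irr)
    fix b x assume "x \<in> ?N"
    then show "X b x \<in> ?N"
    proof (induction rule: span_induct_alt)
      case (step r x y)
      then obtain n where n: "x = L n v" by auto
      have "X b x \<in> ?N"
      proof (cases "\<exists>m. b = bL m")
        case True
        then obtain m where "b = bL m" by auto
        then have "X b x = scale (1 - of_int n) (L (m + n) v)"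
          using T_zero[of m n] n by (simp add: T_def)
        moreover have "L (m + n) v \<in> ?N" by (intro span_base) auto
        ultimately show ?thesis by (simp add: span_scale)
      qed (use not_L_zero[of b] in \<open>auto simp: span_zero\<close>)
      then show ?case using step by (simp add: X_lin span_add span_scale)
    qed (simp add: span_zero)
  next
    fix x assume "x \<in> ?N"
    then show "sg x \<in> ?N"
    proof (induction rule: span_induct_alt)
      case (step r x y)
      then obtain n where "x = L n v" by auto
      then have "sg x = scale e x" by (simp add: sg_X assms(2) X_scale)
      then show ?case using step by (simp add: sg_add sg_scale span_add span_scale span_base)
    qed (simp add: span_zero)
  qed simp
  moreover have "L 0 v \<in> ?N" by (intro span_base) auto
  ultimately have U: "?N = UNIV" using assms(1) by (auto simp: L0_v)
  have "wsp (-1 + of_int 0) \<subseteq> span {L 0 v}"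
  proof
    fix x assume x: "x \<in> wsp (-1 + of_int 0)"
    show "x \<in> span {L 0 v}"
    proof (rule span_wsp(1)[where \<nu> = "\<lambda>n. -1 + of_int n" and W = "\<lambda>n. {L n v}", OF _ _ _ x])
      show "{L i v} \<subseteq> wsp (- 1 + of_int i)" for i
        using v(1) by (auto intro!: X_wsp)
    qed (use U in \<open>auto simp: inj_def\<close>)
  qed
  then show ?thesis by (intro finite_dim_subset[OF finite_dim_span[of "{L 0 v}"]]) auto
qed

end

end

section \<open>The Witt algebra next to the gap: determination of \<open>c\<close>\<close>

locale W22_Witt_gap = W22_gap + W22_Witt +
  assumes c_2: "c \<noteq> 2"
begin

lemma good_3: "good d v \<Longrightarrow> 3 \<le> d \<Longrightarrow> deg a1 + deg a2 + deg a3 = 1 \<Longrightarrow>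
    \<bar>deg a1\<bar> \<le> 6 \<Longrightarrow> \<bar>deg a2\<bar> \<le> 6 \<Longrightarrow> \<bar>deg a3\<bar> \<le> 6 \<Longrightarrow> X a1 (X a2 (X a3 v)) = 0"
  unfolding good_def by (auto dest!: spec[of _ "[a1, a2, a3]"])

lemma good_L2_zero:
  assumes "good d v" "1 \<le> d" "L 2 v = 0"
  shows "v = 0"
  using singular_up[OF good_wsp[OF assms(1)]] good_1[OF assms(1,2), of "bL 1"] assms(3) by simp

lemma L0_L: "good d v \<Longrightarrow> L 0 (L n v) = scale (c - of_int n) (L n v)"
  using LL[of 0 n v] good_L0[of d v] by (simp add: X_lin scale_left_diff_distrib)

text \<open>As in degree 2, apply \<open>L_1\<close> to known relations: once to the formula for
  \<open>L_(-1) L_3 v\<close>, and twice to the degree 1 relation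
  \<open>L_(-2) L_3 v = 0\<close>.\<close>

lemma lower_4_5:
  assumes "good d v" "3 \<le> d"
  shows "L (-1) (L 4 v) = scale (2 * c - 5) (L 3 v)" "L (-2) (L 5 v) = scale (3 * c - 7) (L 3 v)"
proof -
  have 2: "L (-2) (L 3 v) = 0" using good_2[OF assms(1), of "bL (-2)" "bL 3"] assms(2) by simp
  note raise = good_L_raise(1)[OF assms(1), of 2] good_L_raise(1)[OF assms(1), of 3]
    good_L_raise(1)[OF assms(1), of 4]
  note A = good_lower_3(1)[OF assms]
  have B: "scale 2 (L (-2) (L 4 v)) = scale 3 (L (-1) (L 3 v))"
    using LL[of 1 "-2" "L 3 v"] 2 raise assms(2) by (simp add: X_lin)
  have C: "L 1 (L (-1) (L 3 v)) = scale 2 (scale (c - 3) (L 3 v)) - scale 2 (L (-1) (L 4 v))"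
    using LL[of 1 "-1" "L 3 v"] raise L0_L[OF assms(1), of 3] assms(2) by (simp add: X_lin)
  have D: "L 1 (L (-2) (L 4 v)) = scale 3 (L (-1) (L 4 v)) - scale 3 (L (-2) (L 5 v))"
    using LL[of 1 "-2" "L 4 v"] raise assms(2) by (simp add: X_lin)
  have A': "L 1 (L (-1) (L 3 v)) = - scale (2 * c - 4) (L 3 v)"
    unfolding A using raise assms(2) by (simp add: X_lin)
  show E: "L (-1) (L 4 v) = scale (2 * c - 5) (L 3 v)"
  proof (rule vec_eqI)
    fix \<phi> assume "module_hom scale (*) \<phi>"
    then interpret \<phi>: module_hom scale "(*)" \<phi> .
    have "2 * ((c - 3) * \<phi> (L 3 v)) - 2 * \<phi> (L (-1) (L 4 v)) = - ((2 * c - 4) * \<phi> (L 3 v))"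
      using arg_cong[OF C[unfolded A'], of \<phi>] by (simp only: \<phi>.scale \<phi>.diff \<phi>.neg)
    then show "\<phi> (L (-1) (L 4 v)) = \<phi> (scale (2 * c - 5) (L 3 v))"
      unfolding \<phi>.scale by algebra
  qed
  show "L (-2) (L 5 v) = scale (3 * c - 7) (L 3 v)"
  proof (rule vec_eqI)
    fix \<phi> assume "module_hom scale (*) \<phi>"
    then interpret \<phi>: module_hom scale "(*)" \<phi> .
    have "2 * (3 * ((2 * c - 5) * \<phi> (L 3 v)) - 3 * \<phi> (L (-2) (L 5 v))) =
        3 * (- ((2 * c - 4) * \<phi> (L 3 v)))"
      using arg_cong[OF arg_cong[OF B, of "L 1"], of \<phi>]
      by (simp only: X_scale A' D E \<phi>.scale \<phi>.diff \<phi>.neg)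
    then show "\<phi> (L (-2) (L 5 v)) = \<phi> (scale (3 * c - 7) (L 3 v))"
      unfolding \<phi>.scale by algebra
  qed
qed

text \<open>The difference \<open>?e\<close> of the two sides is again good. A direct computation
  gives \<open>L_3 ?e = 0\<close>, so \<open>L_2 ?e = 0\<close>, and \<open>?e\<close> is
  singular.\<close>

lemma lower_raise:
  assumes "good d v" "5 \<le> d"
  shows "L (-2) (L 2 v) = scale (- c) v"
proof -
  have d: "3 \<le> d" "2 \<le> d" using assms(2) by auto
  have 2: "L (-2) (L 3 v) = 0" using good_2[OF assms(1) d(2), of "bL (-2)" "bL 3"] by simp
  let ?e = "L (-2) (L 2 v) + scale c v"
  have "L 3 ?e = 0"
  proof (rule vec_eqI)
    fix \<phi> assume "module_hom scale (*) \<phi>"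
    then interpret \<phi>: module_hom scale "(*)" \<phi> .
    have "L 1 (L 2 v) = - L 3 v" using good_L_raise(1)[OF assms(1), of 2] assms(2) by simp
    moreover have "L (-2) (L 2 (L 3 v)) = - scale 4 (scale (c - 3) (L 3 v))"
      using LL[of "-2" 2 "L 3 v"] 2 L0_L[OF assms(1), of 3] by (simp add: scale_left_diff_distrib)
    moreover have "L 3 (L 2 v) = L 2 (L 3 v) + L 5 v" using LL[of 3 2 v] by simp
    ultimately have eq: "L 3 (L (-2) (L 2 v)) =
        - scale 4 (scale (c - 3) (L 3 v)) + scale (3 * c - 7) (L 3 v) - scale 5 (L 3 v)"
      using LL[of 3 "-2" "L 2 v"] lower_4_5(2)[OF assms(1) d(1)] by (simp add: X_add)
    show "\<phi> (L 3 ?e) = \<phi> 0"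
      unfolding X_add X_scale eq \<phi>.add \<phi>.scale \<phi>.diff \<phi>.neg \<phi>.zero by algebra
  qed
  moreover have e: "good 3 ?e"
    using subspace_add[OF good_subspace, of "L (-2) (L 2 v)" 3 "scale c v"]
      subspace_scale[OF good_subspace, of v 3 c] good_append2[OF assms(1), of 3 "bL (-2)" "bL 2"]
      good_append[OF assms(1), of "[]" 3] assms(2) by simp
  ultimately have "L 2 ?e = 0" using good_3_imp_2(1)[OF e _ c_2] by simp
  then have "?e = 0" using good_L2_zero[OF e] by simp
  then show ?thesis by (simp add: eq_neg_iff_add_eq_0)
qed

lemma c_eq_1:
  assumes "good d v" "5 \<le> d" "v \<noteq> 0"
  shows "c = 1" and "L (-1) (L (-1) v) = scale 2 (L (-2) v)"
proof -
  have d: "3 \<le> d" "2 \<le> d" "1 \<le> d" using assms(2) by auto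
  have L2: "L 2 v \<noteq> 0" using good_L2_zero[OF assms(1) d(3)] assms(3) by auto
  then have L3: "L 3 v \<noteq> 0" using good_3_imp_2(1)[OF assms(1) d(1) c_2] by auto
  \<comment> \<open>For \<open>c = 0\<close>, \<open>L_2 v\<close> would be killed by
    \<open>L_(-2)\<close> and hence be a singular vector for the lowering letters.\<close>
  have c0: "c \<noteq> 0"
  proof
    assume "c = 0"
    have "L 2 v = 0"
    proof (rule good_singular_down[OF assms(1) d(2)])
      show "X b (L 2 v) = 0" if "deg b = -2" for b
        using that lower_raise[OF assms(1,2)] \<open>c = 0\<close> not_L_zero[of b] by (cases b) auto
    qed simp
    then show False using L2 by simp
  qed
  let ?u = "L (-1) v"
  have v1: "L 1 v = 0" using good_1[OF assms(1) d(3), of "bL 1"] by simp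
  have u2: "L 2 ?u = 0" using good_2[OF assms(1) d(2), of "bL 2" "bL (-1)"] by simp
  note u3 = good_lower_3(3)[OF assms(1) d(1)]
  have u1: "L 1 ?u = scale (2 * c) v" using LL[of 1 "-1" v] v1 good_L0[OF assms(1)] by simp
  have u0: "L 0 ?u = scale (c + 1) ?u"
    using L0_L[OF assms(1), of "-1"] by simp
  note raise = good_L_raise(1)[OF assms(1) d(3), of 2] good_L_raise(1)[OF assms(1) d(3), of 3]
  have u4: "L 4 ?u = scale (2 * c) (L 3 v)"
  proof (rule vec_eqI)
    fix \<phi> assume "module_hom scale (*) \<phi>"
    then interpret \<phi>: module_hom scale "(*)" \<phi> .
    have "scale (2 * c) (- L 3 v) = scale (2 * c) (L 3 v) - scale 2 (L 4 ?u)"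
      using LL[of 1 3 ?u] u1 u3 raise by (simp add: X_scale)
    from arg_cong[OF this, of \<phi>] show "\<phi> (L 4 ?u) = \<phi> (scale (2 * c) (L 3 v))"
      unfolding \<phi>.scale \<phi>.diff \<phi>.neg by algebra
  qed
  have u5: "L 5 ?u = scale (2 * c) (L 4 v)"
  proof (rule vec_eqI)
    fix \<phi> assume "module_hom scale (*) \<phi>"
    then interpret \<phi>: module_hom scale "(*)" \<phi> .
    have "scale (2 * c) (- scale 2 (L 4 v)) = scale (2 * c) (L 4 v) - scale 3 (L 5 ?u)"
      using LL[of 1 4 ?u] u1 u4 raise by (simp add: X_scale)
    from arg_cong[OF this, of \<phi>] show "\<phi> (L 5 ?u) = \<phi> (scale (2 * c) (L 4 v))"
      unfolding \<phi>.scale \<phi>.diff \<phi>.neg by algebra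
  qed
  let ?y = "L (-2) v"
  \<comment> \<open>The coefficients are those of the degree 2 singular vector of a Verma module and
    make \<open>L_1 z = 0\<close>. Since \<open>L_3 z\<close> and \<open>L_5 z\<close> vanish too,
    \<open>[L_3, L_2] = L_5\<close> forces \<open>L_3 L_2 z = 0\<close>, that is
    \<open>12 c (1 - c) L_3 v = 0\<close>. For \<open>c = 1\<close> then \<open>z = 0\<close>, which
    is the second claim.\<close>
  define z where "z = scale 3 (L (-1) ?u) - scale (4 * c + 2) ?y"
  have z_wsp: "z \<in> wsp (\<nu>0 - 3)"
    unfolding z_def using good_wsp[OF assms(1)]
    by (intro subspace_diff subspace_scale subspace_wsp X_wsp[of _ "\<nu>0 - 2"] X_wsp[of v "\<nu>0 - 1" "\<nu>0 - 2"]
        X_wsp[of v "\<nu>0 - 1" "\<nu>0 - 3"]) auto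
  have uu: "L 1 (L (-1) ?u) = scale (2 * c) ?u + scale 2 (scale (c + 1) ?u)"
    "L 2 (L (-1) ?u) = scale 3 (scale (2 * c) v)"
    "L 5 (L (-1) ?u) = scale (2 * c) (scale (2 * c - 5) (L 3 v)) + scale 6 (scale (2 * c) (L 3 v))"
    using LL[of 1 "-1" ?u] LL[of 2 "-1" ?u] LL[of 5 "-1" ?u] u0 u1 u2 u4 u5
      lower_4_5(1)[OF assms(1) d(1)]
    by (simp_all only: X_scale X_zero) simp_all
  have yy: "L 1 ?y = scale 3 ?u" "L 2 ?y = scale (- c) v + scale 4 (scale c v)"
    "L 5 ?y = scale (3 * c - 7) (L 3 v) + scale 7 (L 3 v)"
    using LL[of 1 "-2" v] LL[of 2 "-2" v] LL[of 5 "-2" v] v1 good_L0[OF assms(1)]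
      lower_raise[OF assms(1,2)] lower_4_5(2)[OF assms(1) d(1)] by simp_all
  have z1: "L 1 z = 0"
  proof (rule vec_eqI)
    fix \<phi> assume "module_hom scale (*) \<phi>"
    then interpret \<phi>: module_hom scale "(*)" \<phi> .
    show "\<phi> (L 1 z) = \<phi> 0"
      unfolding z_def X_diff X_scale uu yy \<phi>.scale \<phi>.diff \<phi>.add \<phi>.zero by algebra
  qed
  have z2: "L 2 z = scale (12 * c * (1 - c)) v"
  proof (rule vec_eqI)
    fix \<phi> assume "module_hom scale (*) \<phi>"
    then interpret \<phi>: module_hom scale "(*)" \<phi> .
    show "\<phi> (L 2 z) = \<phi> (scale (12 * c * (1 - c)) v)"
      unfolding z_def X_diff X_scale uu yy \<phi>.scale \<phi>.diff \<phi>.add \<phi>.zero by algebra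
  qed
  have z5: "L 5 z = 0"
  proof (rule vec_eqI)
    fix \<phi> assume "module_hom scale (*) \<phi>"
    then interpret \<phi>: module_hom scale "(*)" \<phi> .
    show "\<phi> (L 5 z) = \<phi> 0"
      unfolding z_def X_diff X_scale uu yy \<phi>.scale \<phi>.diff \<phi>.add \<phi>.zero by algebra
  qed
  have z3: "L 3 z = 0"
    using good_2[OF assms(1) d(2), of "bL 3" "bL (-2)"]
      good_3[OF assms(1) d(1), of "bL 3" "bL (-1)" "bL (-1)"]
    by (simp add: z_def X_lin)
  have "scale (12 * c * (1 - c)) (L 3 v) = 0"
    using LL[of 3 2 z] z2 z3 z5 by (simp add: X_scale)
  then show c1: "c = 1" using L3 c0 by simp
  have "L 2 z = 0" using z2 c1 by simp
  then have "z = 0" using singular_up[OF z_wsp z1] by simp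
  show "L (-1) ?u = scale 2 ?y"
  proof (rule vec_eqI)
    fix \<phi> assume "module_hom scale (*) \<phi>"
    then interpret \<phi>: module_hom scale "(*)" \<phi> .
    have "3 * \<phi> (L (-1) ?u) - (4 * 1 + 2) * \<phi> ?y = 0"
      using arg_cong[OF \<open>z = 0\<close>[unfolded z_def c1], of \<phi>]
      by (simp only: \<phi>.scale \<phi>.diff \<phi>.zero)
    then show "\<phi> (L (-1) ?u) = \<phi> (scale 2 ?y)"
      unfolding \<phi>.scale by algebra
  qed
qed

lemma good_sg: "good d v \<Longrightarrow> good d (sg v)"
  unfolding good_def using sg_wsp sg_word[of _ v]
  by (metis sg_zero scale_eq_0_iff)

lemma impossible: False
proof -
  obtain v0 where "v0 \<noteq> 0" "good 5 v0" using ex_good by blast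
  then obtain v e where v: "v \<noteq> 0" "good 5 v" "sg v = scale e v"
    using homogeneous_element[OF good_subspace[of 5], of v0] good_sg
    by (metis (no_types, lifting) mem_Collect_eq)
  note c1 = c_eq_1[OF v(2) _ v(1)]
  have \<nu>0: "\<nu>0 - 1 = - 1" using c1(1) by (simp add: c_def)
  have "finite_dim (wsp (-1))"
  proof (rule finite_dim_wsp[OF _ _ _ _ _ v(1,3)])
    show "v \<in> wsp (-1)" using good_wsp[OF v(2)] by (simp add: \<nu>0)
    show "L 1 v = 0" using good_1[OF v(2), of "bL 1"] by simp
    show "L (-1) (L 2 v) = 0" using good_2[OF v(2), of "bL (-1)" "bL 2"] by simp
    show "L (-2) (L 2 v) = - v" using lower_raise[OF v(2)] c1(1) by simp
    show "L (-1) (L (-1) v) = scale 2 (L (-2) v)" using c1(2) by simp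
  qed
  then show False using gap(2) \<nu>0 by simp
qed

end

section \<open>All weight spaces are infinite-dimensional\<close>

context W22_gap
begin

text \<open>The order \<open>H\<close>, \<open>I\<close>, \<open>G\<close> matters:
  \<open>[I, G]\<close> lies in \<open>H\<close> and \<open>[G, G]\<close> in \<open>I\<close>, so
  each family satisfies the ideal conditions once the earlier ones act as zero.\<close>

lemma impossible_if: "c \<noteq> 2 \<Longrightarrow> False"
proof -
  assume c_2: "c \<noteq> 2"
  interpret H: W22_odd_ideal scale X sg \<nu>0 bH "1 / 2"
  proof unfold_locales
    fix b assume b: "\<And>m. b \<noteq> bL m"
    show "\<exists>e. e \<noteq> 0 \<and> (\<forall>n x. X (bH n) (X b x) = scale e (X b (X (bH n) x)))"
    proof (cases "\<exists>m. b = bI m")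
      case True
      then show ?thesis by (intro exI[of _ 1]) (auto simp: IH)
    next
      case False
      have "X (bH n) (X b x) = scale (-1) (X b (X (bH n) x))" for n x
      proof (cases b)
        case (bG m)
        show ?thesis unfolding bG using GH[of m n x] by (simp add: minus_equation_iff)
      next
        case (bH m)
        show ?thesis unfolding bH using HH[of n m x] by simp
      qed (use b False in auto)
      then show ?thesis by (intro exI[of _ "-1"]) simp
    qed
  next
    show "X (bL m) (X (bH n) x) = X (bH n) (X (bL m) x) +
        scale (1 / 2 * of_int m - of_int n) (X (bH (m + n)) x)" for m n x
      using LH[of m n x] by simp
    show "X (bH m) (X (bH n) x) = - X (bH n) (X (bH m) x)" for m n x
      by (rule HH)
  qed simp_all
  interpret W22_no_H scale X sg \<nu>0
    by unfold_locales (rule H.B_zero)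
  note I_zero = I_zero[OF c_2]
  interpret G: W22_odd_ideal scale X sg \<nu>0 bG "1 / 2"
  proof unfold_locales
    fix b assume b: "\<And>m. b \<noteq> bL m"
    have "X (bG n) (X b x) = scale (-1) (X b (X (bG n) x))" for n x
    proof (cases b)
      case (bG m)
      show ?thesis unfolding bG using GG[of n m x] by (simp add: I_zero)
    qed (use b in \<open>auto simp: I_zero H_zero\<close>)
    then show "\<exists>e. e \<noteq> 0 \<and> (\<forall>n x. X (bG n) (X b x) = scale e (X b (X (bG n) x)))"
      by (intro exI[of _ "-1"]) simp
  next
    show "X (bG m) (X (bG n) x) = - X (bG n) (X (bG m) x)" for m n x
      using GG[of m n x] by (simp add: I_zero)
    show "X (bL m) (X (bG n) x) = X (bG n) (X (bL m) x) +
        scale (1 / 2 * of_int m - of_int n) (X (bG (m + n)) x)" for m n x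
      using LG[of m n x] by simp
  qed simp_all
  interpret W22_Witt_gap scale X sg \<nu>0
  proof unfold_locales
    show "X b x = 0" if "\<And>m. b \<noteq> bL m" for b x
      using that by (cases b) (auto simp: I_zero H_zero G.B_zero)
  qed (rule c_2)
  show False by (rule impossible)
qed

end

text \<open>The flip replaces \<open>c\<close> by \<open>2 - c\<close>.\<close>

lemma (in W22_gap) gap_impossible: False
proof (cases "c = 2")
  case True
  interpret f: W22_inf scale flip sg by (rule flip_W22_inf)
  interpret f: W22_gap scale flip sg "- \<nu>0"
  proof unfold_locales
    have "- (- \<nu>0 - 1) = \<nu>0 + 1" "- (- \<nu>0 + 1) = \<nu>0 - 1" by simp_all
    then show "finite_dim (f.wsp (- \<nu>0))" "\<not> finite_dim (f.wsp (- \<nu>0 - 1))"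
      "\<not> finite_dim (f.wsp (- \<nu>0 + 1))"
      using gap by (simp_all only: flip_wsp minus_minus not_False_eq_True)
  qed
  have "f.c = 2 - c" by (simp add: c_def f.c_def)
  then have "f.c \<noteq> 2" using True by simp
  then show False by (rule f.impossible_if)
qed (rule impossible_if)

context W22_inf
begin

text \<open>If the weights \<open>\<nu> + 1\<close> and \<open>\<nu> + 2\<close> both had
  finite-dimensional spaces, the letters of degree 1 and 2 would have a common zero, a singular
  vector. Otherwise \<open>\<nu> + 1\<close> is an isolated gap.\<close>

lemma infinite_dim_next:
  assumes "\<not> finite_dim (wsp \<nu>)"
  shows "\<not> finite_dim (wsp (\<nu> + 1))"
proof
  assume fin: "finite_dim (wsp (\<nu> + 1))"
  show False
  proof (cases "finite_dim (wsp (\<nu> + 2))")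
    case True
    let ?F = "(\<lambda>b. [b]) ` {b. deg b = 1 \<or> deg b = 2}"
    have "finite ?F"
      by (intro finite_imageI finite_subset[OF _ finite_bounded_letters[of 2]]) auto
    then obtain v where v: "v \<noteq> 0" "v \<in> wsp \<nu>" "\<And>ws. ws \<in> ?F \<Longrightarrow> foldr X ws v = 0"
      by (rule common_zero[OF assms]) (use fin True in auto)
    have "X b v = 0" if "deg b = 1 \<or> deg b = 2" for b
      using v(3)[of "[b]"] that by auto
    then show False using no_singular_up[OF v(2)] v(1) by blast
  next
    case False
    interpret W22_gap scale X sg "\<nu> + 1"
      by unfold_locales (use fin False assms in \<open>simp_all add: add.assoc\<close>)
    show False by (rule gap_impossible)
  qed
qed

lemma infinite_dim_prev:
  assumes "\<not> finite_dim (wsp \<nu>)"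
  shows "\<not> finite_dim (wsp (\<nu> - 1))"
proof -
  interpret f: W22_inf scale flip sg by (rule flip_W22_inf)
  show ?thesis using f.infinite_dim_next[of "- \<nu>"] assms by (simp add: flip_wsp)
qed

lemma infinite_dim_shift:
  assumes "\<not> finite_dim (wsp \<nu>)"
  shows "\<not> finite_dim (wsp (\<nu> + of_int k))"
proof (induction k rule: int_induct[where k = 0])
  case (step1 i)
  then show ?case using infinite_dim_next by (simp add: add.assoc[symmetric])
next
  case (step2 i)
  then show ?case using infinite_dim_prev by (simp add: add_diff_eq)
qed (use assms in simp)

end

section \<open>Weight modules\<close>

definition (in super_vector_space) parity_involution :: "'a \<Rightarrow> 'a" where
  "parity_involution v = (THE w. \<exists>x\<in>grade 0. \<exists>y\<in>grade 1. v = x + y \<and> w = x - y)"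

context super_vector_space
begin

lemma parity_involution_add:
  assumes "x \<in> grade 0" "y \<in> grade 1"
  shows "parity_involution (x + y) = x - y"
  unfolding parity_involution_def
proof (rule the_equality)
  fix w assume "\<exists>x'\<in>grade 0. \<exists>y'\<in>grade 1. x + y = x' + y' \<and> w = x' - y'"
  then obtain x' y' where w: "x' \<in> grade 0" "y' \<in> grade 1" "x + y = x' + y'" "w = x' - y'" by blast
  then have "x - x' = y' - y" by (simp add: algebra_simps)
  moreover have "x - x' \<in> grade 0" "y' - y \<in> grade 1"
    using assms w grade_subspace by (auto intro: subspace_diff)
  ultimately have "x - x' \<in> grade 0 \<inter> grade 1" by simp
  then have "x = x'" by (simp add: grade_disjoint)
  then show "w = x - y" using w by simp
qed (use assms in blast)

lemma grade_cases:
  obtains x y where "x \<in> grade 0" "y \<in> grade 1" "v = x + y"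
  using grade_sum[of v] by blast

lemma parity_involution_linear:
  "parity_involution (v + w) = parity_involution v + parity_involution w"
  "parity_involution (scale r v) = scale r (parity_involution v)"
proof -
  obtain x y where v: "x \<in> grade 0" "y \<in> grade 1" "v = x + y" by (rule grade_cases)
  obtain x' y' where w: "x' \<in> grade 0" "y' \<in> grade 1" "w = x' + y'" by (rule grade_cases)
  have "x + x' \<in> grade 0" "y + y' \<in> grade 1" "scale r x \<in> grade 0" "scale r y \<in> grade 1"
    using v w grade_subspace by (auto intro: subspace_add subspace_scale)
  moreover have "v + w = (x + x') + (y + y')" "scale r v = scale r x + scale r y"
    using v w by (simp_all add: scale_right_distrib)
  ultimately show "parity_involution (v + w) = parity_involution v + parity_involution w"
    "parity_involution (scale r v) = scale r (parity_involution v)"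
    using v w by (simp_all only: parity_involution_add) (simp_all add: scale_right_diff_distrib)
qed

lemma parity_involution_involution: "parity_involution (parity_involution v) = v"
proof -
  obtain x y where v: "x \<in> grade 0" "y \<in> grade 1" "v = x + y" by (rule grade_cases)
  have "parity_involution (x + - y) = x - (- y)"
    using v subspace_neg[OF grade_subspace] by (intro parity_involution_add) auto
  then show ?thesis using v by (simp add: parity_involution_add)
qed

end

context W22_module
begin

abbreviation letter :: "W22_basis \<Rightarrow> 'v \<Rightarrow> 'v" where
  "letter b \<equiv> act (Poly_Mapping.single b 1)"

lemma act_zero [simp]: "act 0 v = 0" "act x 0 = 0"
  using act_scale_left[of 0 0 v] act_scale_right[of x 0 0] by simp_all

lemma act_single: "act (Poly_Mapping.single b r) v = scale r (letter b v)"
  using act_scale_left[of r "Poly_Mapping.single b 1" v] by simp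

lemma letter_letter:
  "letter a (letter b v) = act (W22_basis_bracket a b) v +
     scale (koszul (W22_parity a) (W22_parity b)) (letter b (letter a v))"
proof -
  have s: "Poly_Mapping.single b (1 :: complex) \<in> W22_grade (W22_parity b)" for b
    by (simp add: W22_grade_def)
  show ?thesis using act_bracket[OF s[of a] s[of b], of v] by simp
qed

lemma W22_rep_letter: "W22_rep scale letter parity_involution"
proof unfold_locales
  fix b x
  obtain y z where v: "y \<in> grade 0" "z \<in> grade 1" "x = y + z" by (rule grade_cases)
  have b: "Poly_Mapping.single b (1 :: complex) \<in> W22_grade (W22_parity b)"
    by (simp add: W22_grade_def)
  have minus: "letter b (y - z) = letter b y - letter b z"
    using act_add_right[of _ y "- z"] act_scale_right[of _ "-1" z] by simp
  note g = act_grade[OF b v(1)] act_grade[OF b v(2)]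
  show "parity_involution (letter b x) =
      scale (if W22_parity b = 1 then -1 else 1) (letter b (parity_involution x))"
  proof (cases "W22_parity b = 1")
    case True
    then show ?thesis
      using g parity_involution_add[of "letter b z" "letter b y"]
      by (simp add: v(3) parity_involution_add[OF v(1,2)] act_add_right minus add.commute)
  next
    case False
    then show ?thesis
      using g parity_involution_add[of "letter b y" "letter b z"]
      by (simp add: v(3) parity_involution_add[OF v(1,2)] act_add_right minus)
  qed
  fix m n :: int
  note mult = letter_letter act_single[of _ "of_int m - of_int n"]
    act_single[of _ "of_int m / 2 - of_int n"] act_single[of _ "of_int m - 2 * of_int n"] koszul_def
  show "letter (bL m) (letter (bL n) x) =
      letter (bL n) (letter (bL m) x) + scale (of_int m - of_int n) (letter (bL (m + n)) x)"
    by (subst mult(1)) (simp add: mult(2-5))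
  show "letter (bL m) (letter (bI n) x) =
      letter (bI n) (letter (bL m) x) + scale (of_int m - of_int n) (letter (bI (m + n)) x)"
    by (subst mult(1)) (simp add: mult(2-5))
  show "letter (bL m) (letter (bG n) x) =
      letter (bG n) (letter (bL m) x) + scale (of_int m / 2 - of_int n) (letter (bG (m + n)) x)"
    by (subst mult(1)) (simp add: mult(2-5))
  show "letter (bL m) (letter (bH n) x) =
      letter (bH n) (letter (bL m) x) + scale (of_int m / 2 - of_int n) (letter (bH (m + n)) x)"
    by (subst mult(1)) (simp add: mult(2-5))
  show "letter (bG m) (letter (bG n) x) = - letter (bG n) (letter (bG m) x) + letter (bI (m + n)) x"
    by (subst mult(1)) (simp add: mult(2-5))
  show "letter (bI m) (letter (bG n) x) =
      letter (bG n) (letter (bI m) x) + scale (of_int m - 2 * of_int n) (letter (bH (m + n)) x)"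
    by (subst mult(1)) (simp add: mult(2-5))
  show "letter (bI m) (letter (bI n) x) = letter (bI n) (letter (bI m) x)"
    by (subst mult(1)) (simp add: mult(2-5))
  show "letter (bI m) (letter (bH n) x) = letter (bH n) (letter (bI m) x)"
    by (subst mult(1)) (simp add: mult(2-5))
  show "letter (bG m) (letter (bH n) x) = - letter (bH n) (letter (bG m) x)"
    by (subst mult(1)) (simp add: mult(2-5))
  show "letter (bH m) (letter (bH n) x) = - letter (bH n) (letter (bH m) x)"
    by (subst mult(1)) (simp add: mult(2-5))
qed (simp_all add: act_add_right act_scale_right parity_involution_linear parity_involution_involution)

sublocale rep: W22_rep scale letter parity_involution
  by (rule W22_rep_letter)

lemma weight_space_eq: "weight_space \<nu> = rep.wsp \<nu>"
  by (simp add: weight_space_def rep.wsp_def)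

text \<open>A subspace stable under the involution is graded, because the homogeneous parts of
  \<open>v\<close> are half the sum and half the difference of \<open>v\<close> and its
  image.\<close>

lemma invariant_imp_trivial:
  assumes "irreducible_module" "subspace N" and X: "\<And>b x. x \<in> N \<Longrightarrow> letter b x \<in> N"
    and sg: "\<And>x. x \<in> N \<Longrightarrow> parity_involution x \<in> N"
  shows "N = {0} \<or> N = UNIV"
proof -
  have "submodule N" unfolding submodule_def
  proof (intro conjI ballI allI)
    fix v assume v: "v \<in> N"
    obtain x y where xy: "x \<in> grade 0" "y \<in> grade 1" "v = x + y" by (rule grade_cases)
    have two: "w + w = scale 2 w" for w using scale_left_distrib[of 1 1 w] by simp
    have "v + parity_involution v \<in> N" "v - parity_involution v \<in> N"
      using v sg[OF v] assms(2) by (auto intro: subspace_add subspace_diff)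
    moreover have "v + parity_involution v = scale 2 x" "v - parity_involution v = scale 2 y"
      using xy two[of x] two[of y] by (simp_all add: parity_involution_add)
    ultimately have "scale (1 / 2) (scale 2 x) \<in> N" "scale (1 / 2) (scale 2 y) \<in> N"
      using assms(2) by (auto intro: subspace_scale simp del: scale_scale)
    then show "\<exists>x\<in>N \<inter> grade 0. \<exists>y\<in>N \<inter> grade 1. v = x + y" using xy by auto
  next
    fix x v assume v: "v \<in> N"
    show "act x v \<in> N"
      by (induction x rule: W22_induct)
        (use v X assms(2) in \<open>auto simp: act_add_left act_scale_left
          intro: subspace_0 subspace_add subspace_scale\<close>)
  qed (rule assms(2))
  then show ?thesis using assms(1) by (auto simp: irreducible_module_def)
qed

text \<open>The projection takes the component at \<nu>. It is linear because the decompositions are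
  unique and the pointwise sum or multiple of decompositions is again one.\<close>

lemma weight_projection:
  assumes "weight_module"
  shows "\<exists>p. module_hom scale scale p \<and> (\<forall>x\<in>weight_space \<nu>. p x = x) \<and>
      (\<forall>\<nu>' x. \<nu>' \<noteq> \<nu> \<longrightarrow> x \<in> weight_space \<nu>' \<longrightarrow> p x = 0)"
proof -
  define dec where "dec x f \<longleftrightarrow> finite {\<mu>. f \<mu> \<noteq> 0} \<and> (\<forall>\<mu>. f \<mu> \<in> weight_space \<mu>) \<and>
      x = (\<Sum>\<mu> | f \<mu> \<noteq> 0. f \<mu>)" for x f
  have "\<forall>x. \<exists>!f. dec x f" using assms by (simp add: weight_module_def dec_def)
  then obtain F where F: "\<And>x. dec x (F x)" and uniq: "\<And>x f. dec x f \<Longrightarrow> F x = f"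
    by metis
  have sub: "subspace (weight_space \<mu>)" for \<mu>
    by (simp add: weight_space_eq rep.subspace_wsp)
  have sum: "sum f A = (\<Sum>\<mu> | f \<mu> \<noteq> 0. f \<mu>)" if "finite A" "{\<mu>. f \<mu> \<noteq> 0} \<subseteq> A" for f :: "complex \<Rightarrow> 'v" and A
    using that by (intro sum.mono_neutral_right) auto
  have add: "F (x + y) = (\<lambda>\<mu>. F x \<mu> + F y \<mu>)" for x y
  proof (rule uniq)
    let ?A = "{\<mu>. F x \<mu> \<noteq> 0} \<union> {\<mu>. F y \<mu> \<noteq> 0}"
    have A: "finite ?A" "{\<mu>. F x \<mu> + F y \<mu> \<noteq> 0} \<subseteq> ?A" using F by (auto simp: dec_def)
    have "x + y = sum (F x) ?A + sum (F y) ?A"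
      using sum[OF A(1), of "F x"] sum[OF A(1), of "F y"] F[of x] F[of y] by (simp add: dec_def)
    also have "\<dots> = (\<Sum>\<mu> | F x \<mu> + F y \<mu> \<noteq> 0. F x \<mu> + F y \<mu>)"
      using sum[OF A] by (simp add: sum.distrib)
    finally show "dec (x + y) (\<lambda>\<mu>. F x \<mu> + F y \<mu>)"
      using A finite_subset F sub by (auto simp: dec_def intro: subspace_add)
  qed
  have scale: "F (scale r x) = (\<lambda>\<mu>. scale r (F x \<mu>))" for r x
  proof (rule uniq)
    let ?A = "{\<mu>. F x \<mu> \<noteq> 0}"
    have A: "finite ?A" "{\<mu>. scale r (F x \<mu>) \<noteq> 0} \<subseteq> ?A" using F by (auto simp: dec_def)
    have "scale r x = scale r (sum (F x) ?A)" using F[of x] by (simp add: dec_def)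
    also have "\<dots> = (\<Sum>\<mu> | scale r (F x \<mu>) \<noteq> 0. scale r (F x \<mu>))"
      using sum[OF A] by (simp add: scale_sum_right)
    finally show "dec (scale r x) (\<lambda>\<mu>. scale r (F x \<mu>))"
      using A finite_subset F sub by (auto simp: dec_def intro: subspace_scale)
  qed
  have single: "F x = (\<lambda>\<mu>. if \<mu> = \<nu>' then x else 0)" if "x \<in> weight_space \<nu>'" for x \<nu>'
  proof (rule uniq)
    have A: "{\<mu>. (if \<mu> = \<nu>' then x else 0) \<noteq> 0} \<subseteq> {\<nu>'}" by auto
    show "dec x (\<lambda>\<mu>. if \<mu> = \<nu>' then x else 0)"
      using sum[OF _ A] finite_subset[OF A] that subspace_0[OF sub] by (auto simp: dec_def)
  qed
  have "module_hom scale scale (\<lambda>x. F x \<nu>)"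
    by unfold_locales (simp_all add: add scale)
  then show ?thesis
    by (intro exI[of _ "\<lambda>x. F x \<nu>"]) (auto simp: single)
qed

lemma support_and_dimension:
  assumes "irreducible_module" "weight_module" "infinite_dimensional (weight_space \<mu>)"
  shows "weight_support = {\<mu> + of_int k | k :: int. True}"
    and "infinite_dimensional (weight_space (\<mu> + of_int k))"
proof -
  have inf_iff: "infinite_dimensional (weight_space \<nu>) \<longleftrightarrow> \<not> finite_dim (rep.wsp \<nu>)" for \<nu>
    by (simp add: weight_space_eq infinite_dimensional_iff rep.subspace_wsp)
  interpret W22_inf scale letter parity_involution
  proof unfold_locales
    show "N = {0} \<or> N = UNIV" if "subspace N" "\<And>b x. x \<in> N \<Longrightarrow> letter b x \<in> N"
      "\<And>x. x \<in> N \<Longrightarrow> parity_involution x \<in> N" for N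
      using invariant_imp_trivial[OF assms(1) that] .
    show "\<exists>p. module_hom scale scale p \<and> (\<forall>x\<in>rep.wsp \<nu>. p x = x) \<and>
        (\<forall>\<nu>' x. \<nu>' \<noteq> \<nu> \<longrightarrow> x \<in> rep.wsp \<nu>' \<longrightarrow> p x = 0)" for \<nu>
      using weight_projection[OF assms(2), of \<nu>] by (simp only: weight_space_eq)
    show "\<exists>\<nu>. \<not> finite_dim (rep.wsp \<nu>)" using assms(3) inf_iff by blast
  qed
  have inf: "\<not> finite_dim (rep.wsp (\<mu> + of_int k))" for k
    using infinite_dim_shift assms(3) inf_iff by blast
  then show "infinite_dimensional (weight_space (\<mu> + of_int k))" by (simp add: inf_iff)
  let ?W = "\<lambda>k :: int. rep.wsp (\<mu> + of_int k)"
  \<comment> \<open>The sum of the weight spaces over one coset of the integers is a nonzero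
    submodule, hence everything; other weights then cannot occur.\<close>
  have "span (\<Union>k. ?W k) = {0} \<or> span (\<Union>k. ?W k) = UNIV"
  proof (rule irr)
    fix b x assume "x \<in> span (\<Union>k. ?W k)"
    then show "letter b x \<in> span (\<Union>k. ?W k)"
    proof (induction rule: span_induct_alt)
      case (step r x y)
      then obtain k where "x \<in> ?W k" by auto
      then have "letter b x \<in> ?W (k + deg b)" by (intro rep.X_wsp) auto
      then have "letter b x \<in> span (\<Union>k. ?W k)" by (intro span_base) blast
      then show ?case using step by (simp add: rep.X_lin span_add span_scale)
    qed (simp add: span_zero)
  next
    fix x assume "x \<in> span (\<Union>k. ?W k)"
    then show "parity_involution x \<in> span (\<Union>k. ?W k)"
    proof (induction rule: span_induct_alt)
      case (step r x y)
      then obtain k where "x \<in> ?W k" by auto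
      then have "parity_involution x \<in> ?W k" by (rule rep.sg_wsp)
      then have "parity_involution x \<in> span (\<Union>k. ?W k)" by (intro span_base) blast
      then show ?case using step by (simp add: rep.sg_add rep.sg_scale span_add span_scale)
    qed (simp add: span_zero)
  qed simp
  moreover have "\<not> ?W 0 \<subseteq> {0}" using inf[of 0] finite_dim_zero finite_dim_subset by blast
  moreover have "?W 0 \<subseteq> span (\<Union>k. ?W k)" by (intro subsetI span_base) blast
  ultimately have U: "span (\<Union>k. ?W k) = UNIV" by auto
  have out: "rep.wsp \<nu> = {0}" if "\<nu> \<notin> {\<mu> + of_int k | k :: int. True}" for \<nu>
  proof -
    have "x = 0" if x: "x \<in> rep.wsp \<nu>" for x
    proof (rule span_wsp(2)[where W = ?W and \<nu> = "\<lambda>k. \<mu> + of_int k", OF _ _ _ _ x])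
      show "\<mu> + of_int i \<noteq> \<nu>" for i :: int using \<open>\<nu> \<notin> _\<close> by blast
    qed (use U in \<open>auto simp: inj_def\<close>)
    then show ?thesis using subspace_0[OF rep.subspace_wsp] by blast
  qed
  moreover have "?W k \<noteq> {0}" for k using inf[of k] finite_dim_zero by metis
  ultimately show "weight_support = {\<mu> + of_int k | k :: int. True}"
    unfolding weight_support_def weight_space_eq by blast
qed

end

theorem theorem2p1:
  fixes scale :: "complex \<Rightarrow> 'v::ab_group_add \<Rightarrow> 'v"
    and grade :: "bit \<Rightarrow> 'v set"
    and act :: "W22 \<Rightarrow> 'v \<Rightarrow> 'v"
    and \<mu> :: complex
  assumes "W22_module scale grade act"
    and "lie_supermodule.irreducible_module scale grade act"
    and "W22_module.weight_module scale act"
    and "vector_space.infinite_dimensional scale (W22_module.weight_space scale act \<mu>)"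
  shows "W22_module.weight_support scale act = {\<mu> + of_int k | k :: int. True} \<and>
    (\<forall>k :: int. vector_space.infinite_dimensional scale
       (W22_module.weight_space scale act (\<mu> + of_int k)))"
proof -
  interpret W22_module scale grade act by fact
  show ?thesis using support_and_dimension[OF assms(2-4)] by blast
qed

end
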